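(* Let $A\,|\,B\,|\,C$ be a right depth three tower of rings, and let $V=A^C$, $P=(A\otimes_B A)^C$ and $E=\operatorname{End}{}_BA_C$. The pairing $P\times E\to V$ given by $\langle p,\alpha\rangle=p^1\alpha(p^2)$ is nondegenerate, and it induces an isomorphism of right $V$-modules $E_V\cong\operatorname{Hom}({}_VP,{}_VV)$ via $\alpha\mapsto\langle -,\alpha\rangle$.
   Context: Rings have identity; a tower of rings $A\,|\,B\,|\,C$ is a pair of unital ring homomorphisms $C\to B\to A$, inducing natural bimodule structures. The tower is right depth three if for some positive integer $N$, $A\otimes_B A$ is isomorphic, as an $A$-$C$-bimodule, to a direct summand of $A^N$. $V=A^C$ is the centralizer of $C$ in $A$; $P=\{p\in A\otimes_BA: cp=pc\ \forall c\in C\}$; $E$ is the ring of $B$-$C$-bimodule endomorphisms of $A$. Elements of $P$ are written $p=p^1\otimes_Bp^2$ with a finite summation suppressed. Module structures: $v\cdot p=vp^1\otimes_Bp^2$; $(\alpha\cdot v)(a)=\alpha(a)v$ for $\alpha\in E$; and $(F\cdot v)(p)=F(p)v$ for $F\in\operatorname{Hom}({}_VP,{}_VV)$ (left $V$-linear maps). The pairing is nondegenerate if $\langle p,\alpha\rangle=0$ for all $\alpha\in E$ implies $p=0$, and $\langle p,\alpha\rangle=0$ for all $p\in P$ implies $\alpha=0$. *)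

theory Defs
  imports "HOL-Algebra.Algebra"
begin

section \<open>Towers of rings\<close>

text \<open>
  \<open>\<phi>\<close> is the homomorphism from \<open>B\<close> to \<open>A\<close>, and \<open>\<psi>\<close> the one from \<open>C\<close> to \<open>B\<close>; neither is assumed
  injective. Rings need not be commutative and may be zero; \<^const>\<open>ring_hom\<close> preserves the unit.
\<close>

definition ring_tower ::
  "[('a, 'k) ring_scheme, ('b, 'l) ring_scheme, ('c, 'm) ring_scheme, 'b \<Rightarrow> 'a, 'c \<Rightarrow> 'b] \<Rightarrow> bool"
  where "ring_tower A B C \<phi> \<psi> \<longleftrightarrow>
    ring A \<and> ring B \<and> ring C \<and> \<phi> \<in> ring_hom B A \<and> \<psi> \<in> ring_hom C B"

definition centralizer ::
  "[('a, 'k) ring_scheme, ('c, 'm) ring_scheme, 'b \<Rightarrow> 'a, 'c \<Rightarrow> 'b] \<Rightarrow> ('a, 'k) ring_scheme"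
  where "centralizer A C \<phi> \<psi> =
    A\<lparr>carrier := {a \<in> carrier A. \<forall>c \<in> carrier C. \<phi> (\<psi> c) \<otimes>\<^bsub>A\<^esub> a = a \<otimes>\<^bsub>A\<^esub> \<phi> (\<psi> c)}\<rparr>"

section \<open>Modules and bimodules\<close>

text \<open>
  The modules of HOL-Algebra are over commutative rings, so here the actions are explicit functions.
  The underlying abelian group of a (bi)module is given by the additive part of a ring record;
  where the module has no natural multiplication, the fields \<open>mult\<close> and \<open>one\<close> are \<^const>\<open>undefined\<close>.
\<close>

locale right_module = R: ring R + M: abelian_group M
  for R :: "('r, 'k) ring_scheme" and M :: "('m, 'l) ring_scheme" and act :: "'m \<Rightarrow> 'r \<Rightarrow> 'm" +
  assumes act_closed: "\<lbrakk>x \<in> carrier M; r \<in> carrier R\<rbrakk> \<Longrightarrow> act x r \<in> carrier M"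
    and act_add_left: "\<lbrakk>x \<in> carrier M; y \<in> carrier M; r \<in> carrier R\<rbrakk> \<Longrightarrow>
      act (x \<oplus>\<^bsub>M\<^esub> y) r = act x r \<oplus>\<^bsub>M\<^esub> act y r"
    and act_add_right: "\<lbrakk>x \<in> carrier M; r \<in> carrier R; s \<in> carrier R\<rbrakk> \<Longrightarrow>
      act x (r \<oplus>\<^bsub>R\<^esub> s) = act x r \<oplus>\<^bsub>M\<^esub> act x s"
    and act_mult: "\<lbrakk>x \<in> carrier M; r \<in> carrier R; s \<in> carrier R\<rbrakk> \<Longrightarrow>
      act x (r \<otimes>\<^bsub>R\<^esub> s) = act (act x r) s"
    and act_one: "x \<in> carrier M \<Longrightarrow> act x \<one>\<^bsub>R\<^esub> = x"

definition additive_maps :: "[('m, 'k) ring_scheme, ('n, 'l) ring_scheme] \<Rightarrow> ('m \<Rightarrow> 'n) set"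
  where "additive_maps M N = hom (add_monoid M) (add_monoid N)"

definition right_module_isos ::
  "[('r, 'j) ring_scheme, ('m, 'k) ring_scheme, 'm \<Rightarrow> 'r \<Rightarrow> 'm,
    ('n, 'l) ring_scheme, 'n \<Rightarrow> 'r \<Rightarrow> 'n] \<Rightarrow> ('m \<Rightarrow> 'n) set"
  where "right_module_isos R M act N act' =
    {h \<in> additive_maps M N.
      (\<forall>x \<in> carrier M. \<forall>r \<in> carrier R. h (act x r) = act' (h x) r) \<and>
      bij_betw h (carrier M) (carrier N)}"

definition bimodule_isos ::
  "[('r, 'i) ring_scheme, ('s, 'j) ring_scheme,
    ('m, 'k) ring_scheme, 'r \<Rightarrow> 'm \<Rightarrow> 'm, 'm \<Rightarrow> 's \<Rightarrow> 'm,
    ('n, 'l) ring_scheme, 'r \<Rightarrow> 'n \<Rightarrow> 'n, 'n \<Rightarrow> 's \<Rightarrow> 'n] \<Rightarrow> ('m \<Rightarrow> 'n) set"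
  where "bimodule_isos R S M lact ract N lact' ract' =
    {h \<in> additive_maps M N.
      (\<forall>r \<in> carrier R. \<forall>x \<in> carrier M. h (lact r x) = lact' r (h x)) \<and>
      (\<forall>x \<in> carrier M. \<forall>s \<in> carrier S. h (ract x s) = ract' (h x) s) \<and>
      bij_betw h (carrier M) (carrier N)}"

definition subbimodule ::
  "[('r, 'i) ring_scheme, ('s, 'j) ring_scheme,
    ('m, 'k) ring_scheme, 'r \<Rightarrow> 'm \<Rightarrow> 'm, 'm \<Rightarrow> 's \<Rightarrow> 'm, 'm set] \<Rightarrow> bool"
  where "subbimodule R S M lact ract H \<longleftrightarrow>
    additive_subgroup H M \<and>
    (\<forall>r \<in> carrier R. \<forall>x \<in> H. lact r x \<in> H) \<and> (\<forall>x \<in> H. \<forall>s \<in> carrier S. ract x s \<in> H)"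

definition direct_summand ::
  "[('r, 'i) ring_scheme, ('s, 'j) ring_scheme,
    ('m, 'k) ring_scheme, 'r \<Rightarrow> 'm \<Rightarrow> 'm, 'm \<Rightarrow> 's \<Rightarrow> 'm, 'm set] \<Rightarrow> bool"
  where "direct_summand R S M lact ract H \<longleftrightarrow>
    subbimodule R S M lact ract H \<and>
    (\<exists>K. subbimodule R S M lact ract K \<and> H <+>\<^bsub>M\<^esub> K = carrier M \<and> H \<inter> K = {\<zero>\<^bsub>M\<^esub>})"

definition power_group :: "[nat, ('a, 'k) ring_scheme] \<Rightarrow> (nat \<Rightarrow> 'a) ring"
  where "power_group N A =
    \<lparr>carrier = {..<N} \<rightarrow>\<^sub>E carrier A, monoid.mult = undefined, one = undefined,
     ring.zero = (\<lambda>i\<in>{..<N}. \<zero>\<^bsub>A\<^esub>), ring.add = (\<lambda>x y. \<lambda>i\<in>{..<N}. x i \<oplus>\<^bsub>A\<^esub> y i)\<rparr>"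

section \<open>The tensor square of A over B\<close>

text \<open>
  The free abelian group on \<open>A \<times> A\<close> modulo the relations of biadditivity and \<open>B\<close>-balancedness.
  Elements of the tensor square are thus cosets of \<open>tensor_relations A B \<phi>\<close>.
\<close>

definition tensor_relators ::
  "[('a, 'k) ring_scheme, ('b, 'l) ring_scheme, 'b \<Rightarrow> 'a] \<Rightarrow> ('a \<times> 'a \<Rightarrow>\<^sub>0 int) set"
  where "tensor_relators A B \<phi> =
    {frag_of (x \<oplus>\<^bsub>A\<^esub> x', y) - frag_of (x, y) - frag_of (x', y) | x x' y.
      x \<in> carrier A \<and> x' \<in> carrier A \<and> y \<in> carrier A} \<union>
    {frag_of (x, y \<oplus>\<^bsub>A\<^esub> y') - frag_of (x, y) - frag_of (x, y') | x y y'.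
      x \<in> carrier A \<and> y \<in> carrier A \<and> y' \<in> carrier A} \<union>
    {frag_of (x \<otimes>\<^bsub>A\<^esub> \<phi> b, y) - frag_of (x, \<phi> b \<otimes>\<^bsub>A\<^esub> y) | x b y.
      x \<in> carrier A \<and> b \<in> carrier B \<and> y \<in> carrier A}"

definition tensor_relations ::
  "[('a, 'k) ring_scheme, ('b, 'l) ring_scheme, 'b \<Rightarrow> 'a] \<Rightarrow> ('a \<times> 'a \<Rightarrow>\<^sub>0 int) set"
  where "tensor_relations A B \<phi> =
    generate (free_Abelian_group (carrier A \<times> carrier A)) (tensor_relators A B \<phi>)"

definition tensor_square ::
  "[('a, 'k) ring_scheme, ('b, 'l) ring_scheme, 'b \<Rightarrow> 'a] \<Rightarrow> ('a \<times> 'a \<Rightarrow>\<^sub>0 int) set ring"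
  where "tensor_square A B \<phi> =
    (let Q = free_Abelian_group (carrier A \<times> carrier A) Mod tensor_relations A B \<phi>
     in \<lparr>carrier = carrier Q, monoid.mult = undefined, one = undefined,
         ring.zero = \<one>\<^bsub>Q\<^esub>, ring.add = monoid.mult Q\<rparr>)"

text \<open>
  \<open>tensor_map A B \<phi> s t\<close> is the map \<open>x \<otimes> y \<mapsto> s x \<otimes> t y\<close>: a coset \<open>p\<close> goes to the coset generated
  by the images of its representatives.
\<close>

definition tensor_map ::
  "[('a, 'k) ring_scheme, ('b, 'l) ring_scheme, 'b \<Rightarrow> 'a, 'a \<Rightarrow> 'a, 'a \<Rightarrow> 'a,
    ('a \<times> 'a \<Rightarrow>\<^sub>0 int) set] \<Rightarrow> ('a \<times> 'a \<Rightarrow>\<^sub>0 int) set"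
  where "tensor_map A B \<phi> s t p =
    tensor_relations A B \<phi> <#>\<^bsub>free_Abelian_group (carrier A \<times> carrier A)\<^esub>
      frag_extend (\<lambda>(x, y). frag_of (s x, t y)) ` p"

definition tensor_lact ::
  "[('a, 'k) ring_scheme, ('b, 'l) ring_scheme, 'b \<Rightarrow> 'a, 'a,
    ('a \<times> 'a \<Rightarrow>\<^sub>0 int) set] \<Rightarrow> ('a \<times> 'a \<Rightarrow>\<^sub>0 int) set"
  where "tensor_lact A B \<phi> a = tensor_map A B \<phi> (\<lambda>x. a \<otimes>\<^bsub>A\<^esub> x) (\<lambda>y. y)"

definition tensor_ract ::
  "[('a, 'k) ring_scheme, ('b, 'l) ring_scheme, 'b \<Rightarrow> 'a,
    ('a \<times> 'a \<Rightarrow>\<^sub>0 int) set, 'a] \<Rightarrow> ('a \<times> 'a \<Rightarrow>\<^sub>0 int) set"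
  where "tensor_ract A B \<phi> p a = tensor_map A B \<phi> (\<lambda>x. x) (\<lambda>y. y \<otimes>\<^bsub>A\<^esub> a) p"

definition right_depth_three ::
  "[('a, 'k) ring_scheme, ('b, 'l) ring_scheme, ('c, 'm) ring_scheme, 'b \<Rightarrow> 'a, 'c \<Rightarrow> 'b] \<Rightarrow> bool"
  where "right_depth_three A B C \<phi> \<psi> \<longleftrightarrow>
    ring_tower A B C \<phi> \<psi> \<and>
    (\<exists>N>0. \<exists>H.
      let lact = (\<lambda>a x. \<lambda>i\<in>{..<N}. a \<otimes>\<^bsub>A\<^esub> x i);
          ract = (\<lambda>x c. \<lambda>i\<in>{..<N}. x i \<otimes>\<^bsub>A\<^esub> \<phi> (\<psi> c))
      in direct_summand A C (power_group N A) lact ract H \<and>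
         bimodule_isos A C
           (tensor_square A B \<phi>) (tensor_lact A B \<phi>) (\<lambda>p c. tensor_ract A B \<phi> p (\<phi> (\<psi> c)))
           ((power_group N A)\<lparr>carrier := H\<rparr>) lact ract \<noteq> {})"

section \<open>The modules P and E, and the pairing\<close>

definition tensor_centralizer ::
  "[('a, 'k) ring_scheme, ('b, 'l) ring_scheme, ('c, 'm) ring_scheme, 'b \<Rightarrow> 'a, 'c \<Rightarrow> 'b] \<Rightarrow>
    ('a \<times> 'a \<Rightarrow>\<^sub>0 int) set ring"
  where "tensor_centralizer A B C \<phi> \<psi> =
    (tensor_square A B \<phi>)\<lparr>carrier := {p \<in> carrier (tensor_square A B \<phi>).
      \<forall>c \<in> carrier C. tensor_lact A B \<phi> (\<phi> (\<psi> c)) p = tensor_ract A B \<phi> p (\<phi> (\<psi> c))}\<rparr>"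

text \<open>
  Maps out of \<open>A\<close> (and, below, out of \<open>P\<close>) are taken to be extensional, so that equality of
  functions is equality of maps on the carrier.
\<close>

definition bimodule_End ::
  "[('a, 'k) ring_scheme, ('b, 'l) ring_scheme, ('c, 'm) ring_scheme, 'b \<Rightarrow> 'a, 'c \<Rightarrow> 'b] \<Rightarrow>
    ('a \<Rightarrow> 'a) ring"
  where "bimodule_End A B C \<phi> \<psi> =
    \<lparr>carrier = {\<alpha> \<in> additive_maps A A \<inter> extensional (carrier A).
       (\<forall>b \<in> carrier B. \<forall>a \<in> carrier A. \<alpha> (\<phi> b \<otimes>\<^bsub>A\<^esub> a) = \<phi> b \<otimes>\<^bsub>A\<^esub> \<alpha> a) \<and>
       (\<forall>a \<in> carrier A. \<forall>c \<in> carrier C. \<alpha> (a \<otimes>\<^bsub>A\<^esub> \<phi> (\<psi> c)) = \<alpha> a \<otimes>\<^bsub>A\<^esub> \<phi> (\<psi> c))},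
     monoid.mult = compose (carrier A), one = (\<lambda>a\<in>carrier A. a),
     ring.zero = (\<lambda>a\<in>carrier A. \<zero>\<^bsub>A\<^esub>), ring.add = (\<lambda>\<alpha> \<beta>. \<lambda>a\<in>carrier A. \<alpha> a \<oplus>\<^bsub>A\<^esub> \<beta> a)\<rparr>"

definition End_ract :: "[('a, 'k) ring_scheme, 'a \<Rightarrow> 'a, 'a] \<Rightarrow> 'a \<Rightarrow> 'a"
  where "End_ract A \<alpha> v = (\<lambda>a\<in>carrier A. \<alpha> a \<otimes>\<^bsub>A\<^esub> v)"

text \<open>The left \<open>R\<close>-linear maps from a left \<open>R\<close>-module \<open>M\<close> to \<open>R\<close>, a right \<open>R\<close>-module.\<close>

definition left_dual ::
  "[('r, 'j) ring_scheme, ('m, 'k) ring_scheme, 'r \<Rightarrow> 'm \<Rightarrow> 'm] \<Rightarrow> ('m \<Rightarrow> 'r) ring"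
  where "left_dual R M lact =
    \<lparr>carrier = {F \<in> additive_maps M R \<inter> extensional (carrier M).
       \<forall>r \<in> carrier R. \<forall>x \<in> carrier M. F (lact r x) = r \<otimes>\<^bsub>R\<^esub> F x},
     monoid.mult = undefined, one = undefined,
     ring.zero = (\<lambda>x\<in>carrier M. \<zero>\<^bsub>R\<^esub>), ring.add = (\<lambda>F G. \<lambda>x\<in>carrier M. F x \<oplus>\<^bsub>R\<^esub> G x)\<rparr>"

definition left_dual_ract ::
  "[('r, 'j) ring_scheme, ('m, 'k) ring_scheme, 'm \<Rightarrow> 'r, 'r] \<Rightarrow> 'm \<Rightarrow> 'r"
  where "left_dual_ract R M F r = (\<lambda>x\<in>carrier M. F x \<otimes>\<^bsub>R\<^esub> r)"

text \<open>
  \<open>pairing_rep A \<alpha> u\<close> evaluates \<open>x \<otimes> y \<mapsto> x \<alpha>(y)\<close> on a representative \<open>u\<close>, an integer combination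
  of pairs; \<open>pairing A p \<alpha>\<close> is the common value over all representatives of \<open>p\<close>.
\<close>

definition pairing_rep :: "[('a, 'k) ring_scheme, 'a \<Rightarrow> 'a, 'a \<times> 'a \<Rightarrow>\<^sub>0 int] \<Rightarrow> 'a"
  where "pairing_rep A \<alpha> u =
    (\<Oplus>\<^bsub>A\<^esub>z\<in>Poly_Mapping.keys u.
      [Poly_Mapping.lookup u z] \<cdot>\<^bsub>A\<^esub> (fst z \<otimes>\<^bsub>A\<^esub> \<alpha> (snd z)))"

definition pairing :: "[('a, 'k) ring_scheme, ('a \<times> 'a \<Rightarrow>\<^sub>0 int) set, 'a \<Rightarrow> 'a] \<Rightarrow> 'a"
  where "pairing A p \<alpha> = the_elem (pairing_rep A \<alpha> ` p)"

definition nondegenerate ::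
  "[('p, 'i) ring_scheme, ('e, 'j) ring_scheme, ('v, 'k) ring_scheme, 'p \<Rightarrow> 'e \<Rightarrow> 'v] \<Rightarrow> bool"
  where "nondegenerate P E V f \<longleftrightarrow>
    (\<forall>p \<in> carrier P. (\<forall>\<alpha> \<in> carrier E. f p \<alpha> = \<zero>\<^bsub>V\<^esub>) \<longrightarrow> p = \<zero>\<^bsub>P\<^esub>) \<and>
    (\<forall>\<alpha> \<in> carrier E. (\<forall>p \<in> carrier P. f p \<alpha> = \<zero>\<^bsub>V\<^esub>) \<longrightarrow> \<alpha> = \<zero>\<^bsub>E\<^esub>)"

end

theory Submission
  imports Defs
begin

text \<open>
  Splitting the inclusion of the tensor square into \<open>A\<^sup>N\<close> gives a dual basis: elements
  \<open>\<gamma>\<^sub>i\<close> of \<open>E\<close> and \<open>u\<^sub>i\<close> of \<open>P\<close> with \<open>t = \<Sum>\<^sub>i \<langle>t, \<gamma>\<^sub>i\<rangle> u\<^sub>i\<close> for every tensor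
  \<open>t\<close>. Hence \<open>p\<close> is determined by the values \<open>\<langle>p, \<gamma>\<^sub>i\<rangle>\<close>; taking \<open>t = 1 \<otimes> a\<close>,
  \<open>\<alpha>(a) = \<Sum>\<^sub>i \<gamma>\<^sub>i(a) \<langle>u\<^sub>i, \<alpha>\<rangle>\<close> is determined by the values \<open>\<langle>u\<^sub>i, \<alpha>\<rangle>\<close>; and a \<open>V\<close>-linear
  \<open>F\<close> is the pairing with \<open>\<alpha> = \<Sum>\<^sub>i \<gamma>\<^sub>i(-) F(u\<^sub>i)\<close>.
\<close>

section \<open>Additive maps and pointwise structures\<close>

text \<open>The expansion has to hold on the whole tensor square, with coefficients in
  \<open>A\<close>, because the test tensor 1 \<otimes> a need not lie in \<open>P\<close>. For
  \<open>F\<close> the situation is reversed: it is defined on \<open>P\<close> only and linear over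
  \<open>V\<close> only, so the expansion is fed to it just for p in \<open>P\<close>, where every
  coefficient \<langle>p, \<gamma>_i\<rangle> commutes with \<open>C\<close>. The maps \<gamma>_i
  are the coordinates of the embedding h into A^N, namely \<gamma>_i(a) = h(1 \<otimes> a)_i. Left
  \<open>A\<close>-linearity of h gives h(x \<otimes> y)_i = x \<gamma>_i(y) = \<langle>x \<otimes>
  y, \<gamma>_i\<rangle>, while the relation 1 \<otimes> ba = b \<otimes> a and right
  \<open>C\<close>-linearity of h place \<gamma>_i in \<open>E\<close>. Much of the work comes from
  tensors being cosets in a free abelian group, with actions and pairing defined through
  representatives. Independence of the representative is settled once, for balanced maps; identities
  between additive maps on tensors are then checked on pure tensors.\<close>

lemma additive_mapsI:
  assumes "\<And>x. x \<in> carrier M \<Longrightarrow> f x \<in> carrier N"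
    and "\<And>x y. \<lbrakk>x \<in> carrier M; y \<in> carrier M\<rbrakk> \<Longrightarrow> f (x \<oplus>\<^bsub>M\<^esub> y) = f x \<oplus>\<^bsub>N\<^esub> f y"
  shows "f \<in> additive_maps M N"
  using assms by (auto simp: additive_maps_def hom_def)

lemma additive_maps_closed: "\<lbrakk>f \<in> additive_maps M N; x \<in> carrier M\<rbrakk> \<Longrightarrow> f x \<in> carrier N"
  by (auto simp: additive_maps_def hom_def)

lemma additive_maps_add:
  "\<lbrakk>f \<in> additive_maps M N; x \<in> carrier M; y \<in> carrier M\<rbrakk> \<Longrightarrow> f (x \<oplus>\<^bsub>M\<^esub> y) = f x \<oplus>\<^bsub>N\<^esub> f y"
  by (auto simp: additive_maps_def hom_def)

lemma additive_maps_compose: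
  "\<lbrakk>f \<in> additive_maps L M; g \<in> additive_maps M N\<rbrakk> \<Longrightarrow> (\<lambda>x. g (f x)) \<in> additive_maps L N"
  by (auto simp: additive_maps_def hom_def Pi_iff)

lemma additive_maps_zero:
  assumes "abelian_group M" "abelian_group N" "f \<in> additive_maps M N"
  shows "f \<zero>\<^bsub>M\<^esub> = \<zero>\<^bsub>N\<^esub>"
proof -
  interpret M: abelian_group M by fact
  interpret N: abelian_group N by fact
  have "f \<zero>\<^bsub>M\<^esub> \<oplus>\<^bsub>N\<^esub> f \<zero>\<^bsub>M\<^esub> = f \<zero>\<^bsub>M\<^esub>"
    using additive_maps_add[OF assms(3), of "\<zero>\<^bsub>M\<^esub>" "\<zero>\<^bsub>M\<^esub>"] by simp
  then show ?thesis
    using additive_maps_closed[OF assms(3), of "\<zero>\<^bsub>M\<^esub>"] by (simp add: N.add.l_cancel_one)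
qed

lemma additive_maps_finsum:
  assumes "abelian_group M" "abelian_group N" "f \<in> additive_maps M N"
    and "finite I" "g \<in> I \<rightarrow> carrier M"
  shows "f (\<Oplus>\<^bsub>M\<^esub>i\<in>I. g i) = (\<Oplus>\<^bsub>N\<^esub>i\<in>I. f (g i))"
proof -
  interpret M: abelian_group M by fact
  interpret N: abelian_group N by fact
  show ?thesis
    using assms(4,5)
  proof (induction I rule: finite_induct)
    case empty
    then show ?case using additive_maps_zero[OF assms(1-3)] by simp
  next
    case (insert i I)
    have "(\<lambda>i. f (g i)) \<in> I \<rightarrow> carrier N"
      using insert additive_maps_closed[OF assms(3)] by auto
    with insert show ?case
      by (simp add: M.finsum_insert N.finsum_insert additive_maps_add[OF assms(3)]
          additive_maps_closed[OF assms(3)])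
  qed
qed

lemma finsum_submonoid:
  assumes "abelian_group M" "S \<subseteq> carrier M" "\<zero>\<^bsub>M\<^esub> \<in> S"
    and "\<And>x y. \<lbrakk>x \<in> S; y \<in> S\<rbrakk> \<Longrightarrow> x \<oplus>\<^bsub>M\<^esub> y \<in> S"
    and "finite I" "g \<in> I \<rightarrow> S"
  shows "(\<Oplus>\<^bsub>M\<^esub>i\<in>I. g i) \<in> S"
proof -
  interpret M: abelian_group M by fact
  show ?thesis
    using assms(5,6)
  proof (induction I rule: finite_induct)
    case (insert i I)
    then have "g \<in> I \<rightarrow> carrier M" "g i \<in> carrier M" using assms(2) by auto
    with insert show ?case
      by (simp add: M.finsum_insert assms)
  qed (use assms in simp)
qed

text \<open>One argument serves \<open>power_group\<close>, \<open>E\<close> and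
  \<open>left_dual\<close>: all three consist of extensional functions under pointwise addition.
  \<open>m\<close> and \<open>e\<close> are left arbitrary so that composition in \<open>E\<close>
  and the undefined fields of the other two both fit.\<close>

lemma abelian_group_pointwise:
  assumes "abelian_group N" "S \<subseteq> Y \<rightarrow>\<^sub>E carrier N" "(\<lambda>x\<in>Y. \<zero>\<^bsub>N\<^esub>) \<in> S"
    and "\<And>f g. \<lbrakk>f \<in> S; g \<in> S\<rbrakk> \<Longrightarrow> (\<lambda>x\<in>Y. f x \<oplus>\<^bsub>N\<^esub> g x) \<in> S"
    and "\<And>f. f \<in> S \<Longrightarrow> (\<lambda>x\<in>Y. \<ominus>\<^bsub>N\<^esub> f x) \<in> S"
  shows "abelian_group \<lparr>carrier = S, monoid.mult = m, one = e, ring.zero = (\<lambda>x\<in>Y. \<zero>\<^bsub>N\<^esub>),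
    ring.add = (\<lambda>f g. \<lambda>x\<in>Y. f x \<oplus>\<^bsub>N\<^esub> g x)\<rparr>" (is "abelian_group ?G")
proof -
  interpret N: abelian_group N by fact
  have [simp]: "f x \<in> carrier N" if "f \<in> S" "x \<in> Y" for f x
    using that assms(2) by (auto simp: PiE_def)
  have [simp]: "restrict f Y = f" if "f \<in> S" for f
    using that assms(2) by (auto simp: PiE_def extensional_restrict)
  show ?thesis
  proof (rule abelian_groupI)
    fix f assume "f \<in> carrier ?G"
    then have f: "f \<in> S" by simp
    show "\<exists>g\<in>carrier ?G. g \<oplus>\<^bsub>?G\<^esub> f = \<zero>\<^bsub>?G\<^esub>"
      using f assms(5) N.l_neg
      by (intro bexI[of _ "\<lambda>x\<in>Y. \<ominus>\<^bsub>N\<^esub> f x"]) (auto cong: restrict_cong)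
    show "\<zero>\<^bsub>?G\<^esub> \<oplus>\<^bsub>?G\<^esub> f = f"
      using f by (simp cong: restrict_cong)
    fix g assume "g \<in> carrier ?G"
    then have g: "g \<in> S" by simp
    show "f \<oplus>\<^bsub>?G\<^esub> g = g \<oplus>\<^bsub>?G\<^esub> f"
      using f g by (simp add: N.a_comm cong: restrict_cong)
    fix h assume "h \<in> carrier ?G"
    then have h: "h \<in> S" by simp
    show "f \<oplus>\<^bsub>?G\<^esub> g \<oplus>\<^bsub>?G\<^esub> h = f \<oplus>\<^bsub>?G\<^esub> (g \<oplus>\<^bsub>?G\<^esub> h)"
      using f g h by (simp add: N.a_assoc cong: restrict_cong)
  qed (use assms in auto)
qed

text \<open>The scalars are \<open>A\<close> with a smaller carrier, which is the shape of the
  centralizer. The lemma thus covers both \<open>E\<close>, with values in \<open>A\<close>, and the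
  dual, whose values in \<open>V\<close> are regarded as elements of \<open>A\<close>.\<close>

lemma right_module_pointwise:
  assumes A: "ring A" and V: "ring (A\<lparr>carrier := W\<rparr>)" "W \<subseteq> carrier A"
    and G: "abelian_group G" "carrier G \<subseteq> Y \<rightarrow>\<^sub>E carrier A"
    and add: "\<And>f g. f \<oplus>\<^bsub>G\<^esub> g = (\<lambda>x\<in>Y. f x \<oplus>\<^bsub>A\<^esub> g x)"
    and act: "\<And>f v. \<lbrakk>f \<in> carrier G; v \<in> W\<rbrakk> \<Longrightarrow> (\<lambda>x\<in>Y. f x \<otimes>\<^bsub>A\<^esub> v) \<in> carrier G"
  shows "right_module (A\<lparr>carrier := W\<rparr>) G (\<lambda>f v. \<lambda>x\<in>Y. f x \<otimes>\<^bsub>A\<^esub> v)"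
proof -
  interpret A: ring A by fact
  have [simp]: "f x \<in> carrier A" if "f \<in> carrier G" "x \<in> Y" for f x
    using that G(2) by (auto simp: PiE_def)
  have [simp]: "restrict f Y = f" if "f \<in> carrier G" for f
    using that G(2) by (auto simp: PiE_def extensional_restrict)
  have [simp]: "v \<in> carrier A" if "v \<in> W" for v
    using that V(2) by auto
  show ?thesis
    unfolding right_module_def right_module_axioms_def
    using V(1) G(1) act
    by (simp add: add A.l_distr A.r_distr A.m_assoc cong: restrict_cong)
qed

lemma (in abelian_group) minus_eq_zero_iff:
  "\<lbrakk>x \<in> carrier G; y \<in> carrier G\<rbrakk> \<Longrightarrow> x \<ominus> y = \<zero> \<longleftrightarrow> x = y"
  using minus_equality[of x "\<ominus> y"] by (auto simp: minus_eq r_neg)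

section \<open>Homomorphisms from free abelian groups\<close>

text \<open>The extension of g given by the universal property of the free abelian group. The
  formula is that of \<open>pairing_rep\<close>, which can therefore be folded in later.\<close>

lemma frag_sum_hom:
  assumes "abelian_group M" "g \<in> S \<rightarrow> carrier M"
  defines "h \<equiv> \<lambda>u. \<Oplus>\<^bsub>M\<^esub>z\<in>Poly_Mapping.keys u. [Poly_Mapping.lookup u z] \<cdot>\<^bsub>M\<^esub> g z"
  shows "h \<in> hom (free_Abelian_group S) (add_monoid M)"
    and "\<And>z. z \<in> S \<Longrightarrow> h (frag_of z) = g z"
proof -
  interpret M: abelian_group M by fact
  have g: "[k] \<cdot>\<^bsub>M\<^esub> g z \<in> carrier M" if "z \<in> S" for k :: int and z
    using assms(2) that by (auto intro: M.add.int_pow_closed)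
  \<comment> \<open>Cancellation can make the support of u + w smaller than the union of the two
    supports. Padding with zero terms lets all three sums run over one finite set.\<close>
  have ext: "h u = (\<Oplus>\<^bsub>M\<^esub>z\<in>K. [Poly_Mapping.lookup u z] \<cdot>\<^bsub>M\<^esub> g z)"
    if "finite K" "Poly_Mapping.keys u \<subseteq> K" "K \<subseteq> S" for u K
    unfolding h_def using that g
    by (intro M.add.finprod_mono_neutral_cong_left) (auto simp: in_keys_iff add_pow_def)
  show "h \<in> hom (free_Abelian_group S) (add_monoid M)"
  proof (rule homI)
    fix u assume "u \<in> carrier (free_Abelian_group S)"
    then show "h u \<in> carrier (add_monoid M)"
      unfolding h_def using g by (auto intro!: M.finsum_closed)
  next
    fix u w assume "u \<in> carrier (free_Abelian_group S)" "w \<in> carrier (free_Abelian_group S)"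
    then have S: "Poly_Mapping.keys u \<subseteq> S" "Poly_Mapping.keys w \<subseteq> S" by auto
    let ?K = "Poly_Mapping.keys u \<union> Poly_Mapping.keys w"
    have "h (u + w) = (\<Oplus>\<^bsub>M\<^esub>z\<in>?K. [Poly_Mapping.lookup (u + w) z] \<cdot>\<^bsub>M\<^esub> g z)"
      using S by (intro ext keys_add) auto
    also have "\<dots> = (\<Oplus>\<^bsub>M\<^esub>z\<in>?K. [Poly_Mapping.lookup u z] \<cdot>\<^bsub>M\<^esub> g z \<oplus>\<^bsub>M\<^esub>
        [Poly_Mapping.lookup w z] \<cdot>\<^bsub>M\<^esub> g z)"
      using S g assms(2) by (intro M.finsum_cong') (auto simp: lookup_add M.add.int_pow_mult Pi_iff subset_iff)
    also have "\<dots> = h u \<oplus>\<^bsub>M\<^esub> h w"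
      using S g by (subst M.finsum_addf) (auto simp: ext[of ?K])
    finally show "h (u \<otimes>\<^bsub>free_Abelian_group S\<^esub> w) = h u \<otimes>\<^bsub>add_monoid M\<^esub> h w"
      by simp
  qed
  show "h (frag_of z) = g z" if "z \<in> S" for z
    using assms(2) that M.finsum_insert[of "{}" z "\<lambda>x. [Poly_Mapping.lookup (frag_of z) x] \<cdot>\<^bsub>M\<^esub> g x"]
    by (auto simp: h_def Pi_iff M.add.int_pow_1)
qed

lemma hom_free_Abelian_group_diff:
  assumes "h \<in> hom (free_Abelian_group S) G" "group G"
    and "Poly_Mapping.keys u \<subseteq> S" "Poly_Mapping.keys w \<subseteq> S"
  shows "h (u - w) = h u \<otimes>\<^bsub>G\<^esub> inv\<^bsub>G\<^esub> h w"
proof -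
  interpret h: group_hom "free_Abelian_group S" G h
    using assms by (simp add: group_hom_def group_hom_axioms_def)
  have "h (- w) = inv\<^bsub>G\<^esub> h w"
    using h.hom_inv[of w] assms by simp
  then show ?thesis
    using h.hom_mult[of u "- w"] assms by simp
qed

lemma hom_free_Abelian_group_eq:
  assumes "f \<in> hom (free_Abelian_group S) G" "g \<in> hom (free_Abelian_group S) G" "group G"
    and "\<And>z. z \<in> S \<Longrightarrow> f (frag_of z) = g (frag_of z)" "Poly_Mapping.keys u \<subseteq> S"
  shows "f u = g u"
  using assms(5)
proof (induction rule: free_Abelian_group_induct[consumes 1, case_names zero diff of])
  case zero
  then show ?case
    using assms(1-3) hom_one[of f "free_Abelian_group S" G] hom_one[of g "free_Abelian_group S" G] by simp
qed (use assms in \<open>simp_all add: hom_free_Abelian_group_diff\<close>)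

section \<open>The tensor square\<close>

locale ring_extension = A: ring A + B: ring B
  for A :: "('a, 'k) ring_scheme" and B :: "('b, 'l) ring_scheme" +
  fixes \<phi> :: "'b \<Rightarrow> 'a"
  assumes hom: "\<phi> \<in> ring_hom B A"
begin

lemma hom_closed [simp]: "b \<in> carrier B \<Longrightarrow> \<phi> b \<in> carrier A"
  using hom by (rule ring_hom_closed)

abbreviation "Fr \<equiv> free_Abelian_group (carrier A \<times> carrier A)"
abbreviation "Rel \<equiv> tensor_relations A B \<phi>"
abbreviation "T \<equiv> tensor_square A B \<phi>"
abbreviation "cls u \<equiv> Rel #>\<^bsub>Fr\<^esub> u"

definition pure :: "'a \<Rightarrow> 'a \<Rightarrow> ('a \<times> 'a \<Rightarrow>\<^sub>0 int) set"
  where "pure x y = cls (frag_of (x, y))"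

lemma tensor_relators_subset: "tensor_relators A B \<phi> \<subseteq> carrier Fr"
  unfolding tensor_relators_def
  by (auto dest!: subsetD[OF keys_diff])

lemma subgroup_Rel: "subgroup Rel Fr"
  unfolding tensor_relations_def
  by (intro group.generate_is_subgroup group_free_Abelian_group tensor_relators_subset)

sublocale Fr: comm_group Fr
  by (rule abelian_free_Abelian_group)

sublocale Rel: normal Rel Fr
  by (simp add: Fr.normal_iff_subgroup subgroup_Rel)

lemma carrier_tensor_square: "carrier T = cls ` {u. Poly_Mapping.keys u \<subseteq> carrier A \<times> carrier A}"
  by (auto simp: tensor_square_def Let_def carrier_FactGroup)

lemma cls_in_T: "Poly_Mapping.keys u \<subseteq> carrier A \<times> carrier A \<Longrightarrow> cls u \<in> carrier T"
  by (auto simp: carrier_tensor_square)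

lemma zero_tensor_square: "\<zero>\<^bsub>T\<^esub> = Rel"
  by (simp add: tensor_square_def Let_def)

lemma add_cls:
  assumes "Poly_Mapping.keys u \<subseteq> carrier A \<times> carrier A" "Poly_Mapping.keys w \<subseteq> carrier A \<times> carrier A"
  shows "cls u \<oplus>\<^bsub>T\<^esub> cls w = cls (u + w)"
  using Rel.rcos_sum[of u w] assms by (simp add: tensor_square_def Let_def)

lemma abelian_group_tensor_square: "abelian_group T"
proof -
  interpret Q: comm_group "Fr Mod Rel"
    by (rule Fr.abelian_FactGroup[OF subgroup_Rel])
  have [simp]: "carrier T = carrier (Fr Mod Rel)" "\<zero>\<^bsub>T\<^esub> = \<one>\<^bsub>Fr Mod Rel\<^esub>"
    "x \<oplus>\<^bsub>T\<^esub> y = x \<otimes>\<^bsub>Fr Mod Rel\<^esub> y" for x y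
    by (simp_all add: tensor_square_def Let_def)
  show ?thesis
    by (rule abelian_groupI)
      (simp_all add: Q.m_ac Q.l_inv_ex del: mult_FactGroup one_FactGroup)
qed

sublocale T: abelian_group T
  by (rule abelian_group_tensor_square)

lemma cls_hom: "cls \<in> hom Fr (add_monoid T)"
  by (intro homI) (auto simp: cls_in_T add_cls)

lemma pure_closed [simp]: "\<lbrakk>x \<in> carrier A; y \<in> carrier A\<rbrakk> \<Longrightarrow> pure x y \<in> carrier T"
  by (simp add: pure_def cls_in_T)

section \<open>The universal property of the tensor square\<close>

lemma hom_vanish_relations:
  assumes "abelian_group M" "h \<in> hom Fr (add_monoid M)"
    and "\<And>u. u \<in> tensor_relators A B \<phi> \<Longrightarrow> h u = \<zero>\<^bsub>M\<^esub>" "u \<in> Rel"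
  shows "h u = \<zero>\<^bsub>M\<^esub>"
proof -
  interpret M: abelian_group M by fact
  interpret h: group_hom Fr "add_monoid M" h
    using assms(2) M.add.group_axioms by (simp add: group_hom_def group_hom_axioms_def)
  have "generate Fr (tensor_relators A B \<phi>) \<subseteq> kernel Fr (add_monoid M) h"
    using tensor_relators_subset assms(3)
    by (intro Fr.generate_subgroup_incl h.subgroup_kernel) (auto simp: kernel_def simp del: carrier_free_Abelian_group_iff)
  with assms(4) show ?thesis
    by (auto simp: tensor_relations_def kernel_def)
qed

lemma hom_diff:
  assumes "abelian_group M" "h \<in> hom Fr (add_monoid M)"
    and "Poly_Mapping.keys u \<subseteq> carrier A \<times> carrier A" "Poly_Mapping.keys w \<subseteq> carrier A \<times> carrier A"
  shows "h (u - w) = h u \<ominus>\<^bsub>M\<^esub> h w"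
  using hom_free_Abelian_group_diff[OF assms(2) abelian_group.a_group[OF assms(1)] assms(3,4)]
  by (simp add: a_minus_def a_inv_def)

text \<open>Read from right to left, this shows that a biadditive map kills the additivity relators;
  read from left to right and applied to \<open>cls\<close>, it yields biadditivity of
  \<open>pure\<close>.\<close>

lemma hom_relator_iff:
  assumes "abelian_group M" "h \<in> hom Fr (add_monoid M)"
    and "z \<in> carrier A \<times> carrier A" "z' \<in> carrier A \<times> carrier A" "z'' \<in> carrier A \<times> carrier A"
  shows "h (frag_of z - frag_of z' - frag_of z'') = \<zero>\<^bsub>M\<^esub> \<longleftrightarrow>
    h (frag_of z) = h (frag_of z') \<oplus>\<^bsub>M\<^esub> h (frag_of z'')"
proof -
  interpret M: abelian_group M by fact
  have [simp]: "h (frag_of y) \<in> carrier M" if "y \<in> carrier A \<times> carrier A" for y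
    using assms(2) that by (auto simp: hom_def Pi_iff)
  have "Poly_Mapping.keys (frag_of z - frag_of z') \<subseteq> carrier A \<times> carrier A"
    using assms(3-5) order_trans[OF keys_diff, of "frag_of z" "frag_of z'"] by simp
  then have "h (frag_of z - frag_of z' - frag_of z'') =
      h (frag_of z) \<ominus>\<^bsub>M\<^esub> (h (frag_of z') \<oplus>\<^bsub>M\<^esub> h (frag_of z''))"
    using assms(3-5)
    by (simp add: hom_diff[OF assms(1,2)] M.minus_eq M.minus_add M.a_ac)
  then show ?thesis
    using assms(3-5) by (simp add: M.minus_eq_zero_iff)
qed

text \<open>These are the middle-linear maps, the input of the universal property of the tensor
  square.\<close>

definition balanced :: "('x, 'y) ring_scheme \<Rightarrow> ('a \<Rightarrow> 'a \<Rightarrow> 'x) \<Rightarrow> bool"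
  where "balanced M g \<longleftrightarrow>
    (\<forall>x\<in>carrier A. \<forall>y\<in>carrier A. g x y \<in> carrier M) \<and>
    (\<forall>x\<in>carrier A. \<forall>x'\<in>carrier A. \<forall>y\<in>carrier A. g (x \<oplus>\<^bsub>A\<^esub> x') y = g x y \<oplus>\<^bsub>M\<^esub> g x' y) \<and>
    (\<forall>x\<in>carrier A. \<forall>y\<in>carrier A. \<forall>y'\<in>carrier A. g x (y \<oplus>\<^bsub>A\<^esub> y') = g x y \<oplus>\<^bsub>M\<^esub> g x y') \<and>
    (\<forall>x\<in>carrier A. \<forall>b\<in>carrier B. \<forall>y\<in>carrier A. g (x \<otimes>\<^bsub>A\<^esub> \<phi> b) y = g x (\<phi> b \<otimes>\<^bsub>A\<^esub> y))"

text \<open>Two representatives differ by a relation, and h kills relations because g respects all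
  relators. This is the well-definedness behind both \<open>tensor_map\<close> and
  \<open>pairing\<close>.\<close>

lemma balanced_constant_on_coset:
  assumes "abelian_group M" "h \<in> hom Fr (add_monoid M)" "balanced M g"
    and h: "\<And>x y. \<lbrakk>x \<in> carrier A; y \<in> carrier A\<rbrakk> \<Longrightarrow> h (frag_of (x, y)) = g x y"
    and "w \<in> cls u" "Poly_Mapping.keys u \<subseteq> carrier A \<times> carrier A"
  shows "h w = h u"
proof -
  interpret M: abelian_group M by fact
  have "h r = \<zero>\<^bsub>M\<^esub>" if "r \<in> tensor_relators A B \<phi>" for r
    using that assms(3) unfolding tensor_relators_def balanced_def
    by (auto simp: hom_relator_iff[OF assms(1,2)] hom_diff[OF assms(1,2)] h M.minus_eq_zero_iff)
  moreover obtain r where r: "r \<in> Rel" "w = r + u"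
    using assms(5) by (auto simp: r_coset_def)
  ultimately have "h r = \<zero>\<^bsub>M\<^esub>"
    using hom_vanish_relations[OF assms(1,2)] by blast
  moreover have "r \<in> carrier Fr" using r(1) Rel.subset by blast
  moreover have "h u \<in> carrier M" using assms(2,6) by (auto simp: hom_def Pi_iff)
  ultimately show ?thesis
    using assms(2,6) r(2) by (auto simp: hom_def)
qed

lemma tensor_square_cases:
  assumes "p \<in> carrier T"
  obtains u where "Poly_Mapping.keys u \<subseteq> carrier A \<times> carrier A" "p = cls u"
  using assms by (auto simp: carrier_tensor_square)

text \<open>Both maps are pulled back to the free group along \<open>cls\<close> and compared on
  generators. The module identities for the actions and the pairing are reduced to pure tensors in
  this way.\<close>

lemma tensor_additive_eq:
  assumes "abelian_group M" "f \<in> additive_maps T M" "g \<in> additive_maps T M"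
    and "\<And>x y. \<lbrakk>x \<in> carrier A; y \<in> carrier A\<rbrakk> \<Longrightarrow> f (pure x y) = g (pure x y)"
    and "p \<in> carrier T"
  shows "f p = g p"
proof -
  obtain u where u: "Poly_Mapping.keys u \<subseteq> carrier A \<times> carrier A" "p = cls u"
    using assms(5) by (rule tensor_square_cases)
  have "(\<lambda>u. f (cls u)) \<in> hom Fr (add_monoid M)" "(\<lambda>u. g (cls u)) \<in> hom Fr (add_monoid M)"
    using hom_compose[OF cls_hom, of _ "add_monoid M"] assms(2,3)
    by (auto simp: additive_maps_def comp_def)
  moreover have "f (cls (frag_of z)) = g (cls (frag_of z))" if "z \<in> carrier A \<times> carrier A" for z
    using assms(4) that by (auto simp: pure_def)
  ultimately show ?thesis
    using hom_free_Abelian_group_eq[OF _ _ abelian_group.a_group[OF assms(1)] _ u(1)] u(2) by blast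
qed

lemma additive_maps_cls:
  assumes "h \<in> hom Fr (add_monoid M)"
    and "\<And>u. Poly_Mapping.keys u \<subseteq> carrier A \<times> carrier A \<Longrightarrow> f (cls u) = h u"
  shows "f \<in> additive_maps T M"
proof (rule additive_mapsI)
  fix p assume "p \<in> carrier T"
  then show "f p \<in> carrier M"
    using assms by (elim tensor_square_cases) (auto simp: hom_def Pi_iff)
next
  fix p q assume "p \<in> carrier T" "q \<in> carrier T"
  then obtain u w where uw: "Poly_Mapping.keys u \<subseteq> carrier A \<times> carrier A" "p = cls u"
    "Poly_Mapping.keys w \<subseteq> carrier A \<times> carrier A" "q = cls w"
    by (elim tensor_square_cases) blast
  then have "Poly_Mapping.keys (u + w) \<subseteq> carrier A \<times> carrier A"
    using Poly_Mapping.keys_add[of u w] by blast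
  with uw show "f (p \<oplus>\<^bsub>T\<^esub> q) = f p \<oplus>\<^bsub>M\<^esub> f q"
    using assms by (simp add: add_cls hom_def)
qed

text \<open>\<open>cls\<close> is itself a homomorphism sending each relator to zero, and each of
  the three equations is one family of relators read in the quotient.\<close>

lemma balanced_pure: "balanced T pure"
proof -
  note T = T.abelian_group_axioms cls_hom
  have zero: "cls r = \<zero>\<^bsub>T\<^esub>" if "r \<in> tensor_relators A B \<phi>" for r
  proof -
    have "r \<in> Rel"
      using that by (simp add: tensor_relations_def generate.incl)
    then show ?thesis
      using Fr.coset_join2[OF _ subgroup_Rel] Rel.subset zero_tensor_square by blast
  qed
  show ?thesis
    unfolding balanced_def pure_def
  proof (intro conjI ballI)
    fix x x' y assume "x \<in> carrier A" "x' \<in> carrier A" "y \<in> carrier A"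
    moreover from this have "frag_of (x \<oplus>\<^bsub>A\<^esub> x', y) - frag_of (x, y) - frag_of (x', y) \<in> tensor_relators A B \<phi>"
      unfolding tensor_relators_def by blast
    ultimately show "cls (frag_of (x \<oplus>\<^bsub>A\<^esub> x', y)) = cls (frag_of (x, y)) \<oplus>\<^bsub>T\<^esub> cls (frag_of (x', y))"
      using zero hom_relator_iff[OF T, of "(x \<oplus>\<^bsub>A\<^esub> x', y)" "(x, y)" "(x', y)"] by simp
  next
    fix x y y' assume "x \<in> carrier A" "y \<in> carrier A" "y' \<in> carrier A"
    moreover from this have "frag_of (x, y \<oplus>\<^bsub>A\<^esub> y') - frag_of (x, y) - frag_of (x, y') \<in> tensor_relators A B \<phi>"
      unfolding tensor_relators_def by blast
    ultimately show "cls (frag_of (x, y \<oplus>\<^bsub>A\<^esub> y')) = cls (frag_of (x, y)) \<oplus>\<^bsub>T\<^esub> cls (frag_of (x, y'))"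
      using zero hom_relator_iff[OF T, of "(x, y \<oplus>\<^bsub>A\<^esub> y')" "(x, y)" "(x, y')"] by simp
  next
    fix x b y assume "x \<in> carrier A" "b \<in> carrier B" "y \<in> carrier A"
    moreover from this have "frag_of (x \<otimes>\<^bsub>A\<^esub> \<phi> b, y) - frag_of (x, \<phi> b \<otimes>\<^bsub>A\<^esub> y) \<in> tensor_relators A B \<phi>"
      unfolding tensor_relators_def by blast
    ultimately have "cls (frag_of (x \<otimes>\<^bsub>A\<^esub> \<phi> b, y)) \<ominus>\<^bsub>T\<^esub> cls (frag_of (x, \<phi> b \<otimes>\<^bsub>A\<^esub> y)) = \<zero>\<^bsub>T\<^esub>"
      "cls (frag_of (x \<otimes>\<^bsub>A\<^esub> \<phi> b, y)) \<in> carrier T" "cls (frag_of (x, \<phi> b \<otimes>\<^bsub>A\<^esub> y)) \<in> carrier T"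
      by (simp_all add: cls_in_T zero flip: hom_diff[OF T])
    then show "cls (frag_of (x \<otimes>\<^bsub>A\<^esub> \<phi> b, y)) = cls (frag_of (x, \<phi> b \<otimes>\<^bsub>A\<^esub> y))"
      using T.minus_eq_zero_iff by blast
  qed (simp add: cls_in_T)
qed

section \<open>Induced maps on tensors: the two actions and the pairing\<close>

lemma balanced_pure_compose:
  assumes "s \<in> additive_maps A A" "t \<in> additive_maps A A"
    and "\<And>x b. \<lbrakk>x \<in> carrier A; b \<in> carrier B\<rbrakk> \<Longrightarrow> s (x \<otimes>\<^bsub>A\<^esub> \<phi> b) = s x \<otimes>\<^bsub>A\<^esub> \<phi> b"
    and "\<And>b y. \<lbrakk>b \<in> carrier B; y \<in> carrier A\<rbrakk> \<Longrightarrow> t (\<phi> b \<otimes>\<^bsub>A\<^esub> y) = \<phi> b \<otimes>\<^bsub>A\<^esub> t y"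
  shows "balanced T (\<lambda>x y. pure (s x) (t y))"
  using balanced_pure assms
  by (simp add: balanced_def additive_maps_closed[OF assms(1)] additive_maps_closed[OF assms(2)]
      additive_maps_add[OF assms(1)] additive_maps_add[OF assms(2)])

text \<open>\<open>tensor_map\<close> is a union of cosets, one for each representative. Since s and
  t are compatible with \<open>B\<close> at the inner tensor position, all of these cosets coincide,
  and \<open>u\<close> itself shows that the union is not empty.\<close>

lemma tensor_map_cls:
  assumes "s \<in> additive_maps A A" "t \<in> additive_maps A A"
    and "\<And>x b. \<lbrakk>x \<in> carrier A; b \<in> carrier B\<rbrakk> \<Longrightarrow> s (x \<otimes>\<^bsub>A\<^esub> \<phi> b) = s x \<otimes>\<^bsub>A\<^esub> \<phi> b"
    and "\<And>b y. \<lbrakk>b \<in> carrier B; y \<in> carrier A\<rbrakk> \<Longrightarrow> t (\<phi> b \<otimes>\<^bsub>A\<^esub> y) = \<phi> b \<otimes>\<^bsub>A\<^esub> t y"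
  defines "h \<equiv> \<lambda>u. cls (frag_extend (\<lambda>(x, y). frag_of (s x, t y)) u)"
  shows "h \<in> hom Fr (add_monoid T)"
    and "Poly_Mapping.keys u \<subseteq> carrier A \<times> carrier A \<Longrightarrow> tensor_map A B \<phi> s t (cls u) = h u"
proof -
  let ?e = "frag_extend (\<lambda>(x, y). frag_of (s x, t y))"
  have keys: "Poly_Mapping.keys (?e u) \<subseteq> carrier A \<times> carrier A"
    if "Poly_Mapping.keys u \<subseteq> carrier A \<times> carrier A" for u
    using that additive_maps_closed[OF assms(1)] additive_maps_closed[OF assms(2)]
    by (intro order_trans[OF keys_frag_extend]) auto
  show h: "h \<in> hom Fr (add_monoid T)"
    unfolding h_def by (intro homI) (simp_all add: keys cls_in_T add_cls frag_extend_add)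
  assume u: "Poly_Mapping.keys u \<subseteq> carrier A \<times> carrier A"
  have "h w = h u" if "w \<in> cls u" for w
    by (rule balanced_constant_on_coset[OF T.abelian_group_axioms h balanced_pure_compose[OF assms(1-4)] _ that u])
      (simp_all add: h_def pure_def)
  then have "(\<Union>w\<in>cls u. h w) = (\<Union>w\<in>cls u. h u)"
    by (intro SUP_cong refl)
  moreover have "tensor_map A B \<phi> s t (cls u) = (\<Union>w\<in>cls u. h w)"
    by (auto simp: tensor_map_def set_mult_def r_coset_def h_def)
  moreover have "u \<in> cls u"
    using u Fr.rcos_self[OF _ subgroup_Rel] by simp
  ultimately show "tensor_map A B \<phi> s t (cls u) = h u"
    by auto
qed

lemma tensor_map_additive:
  assumes "s \<in> additive_maps A A" "t \<in> additive_maps A A"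
    and "\<And>x b. \<lbrakk>x \<in> carrier A; b \<in> carrier B\<rbrakk> \<Longrightarrow> s (x \<otimes>\<^bsub>A\<^esub> \<phi> b) = s x \<otimes>\<^bsub>A\<^esub> \<phi> b"
    and "\<And>b y. \<lbrakk>b \<in> carrier B; y \<in> carrier A\<rbrakk> \<Longrightarrow> t (\<phi> b \<otimes>\<^bsub>A\<^esub> y) = \<phi> b \<otimes>\<^bsub>A\<^esub> t y"
  shows "tensor_map A B \<phi> s t \<in> additive_maps T T"
    and "\<lbrakk>x \<in> carrier A; y \<in> carrier A\<rbrakk> \<Longrightarrow> tensor_map A B \<phi> s t (pure x y) = pure (s x) (t y)"
  using additive_maps_cls[OF tensor_map_cls(1,2)[OF assms]] tensor_map_cls(2)[OF assms, of "frag_of (x, y)"]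
  by (simp_all add: pure_def)

lemma mult_left_additive: "a \<in> carrier A \<Longrightarrow> (\<lambda>x. a \<otimes>\<^bsub>A\<^esub> x) \<in> additive_maps A A"
  by (rule additive_mapsI) (simp_all add: A.r_distr)

lemma mult_right_additive: "a \<in> carrier A \<Longrightarrow> (\<lambda>x. x \<otimes>\<^bsub>A\<^esub> a) \<in> additive_maps A A"
  by (rule additive_mapsI) (simp_all add: A.l_distr)

lemma id_additive: "(\<lambda>x. x) \<in> additive_maps M M"
  by (rule additive_mapsI) simp_all

lemma tensor_lact_additive:
  assumes "a \<in> carrier A"
  shows "tensor_lact A B \<phi> a \<in> additive_maps T T"
    and "\<lbrakk>x \<in> carrier A; y \<in> carrier A\<rbrakk> \<Longrightarrow> tensor_lact A B \<phi> a (pure x y) = pure (a \<otimes>\<^bsub>A\<^esub> x) y"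
  unfolding tensor_lact_def
  by (rule tensor_map_additive[OF mult_left_additive[OF assms] id_additive];
      simp add: A.m_assoc assms)+

lemma tensor_ract_additive:
  assumes "a \<in> carrier A"
  shows "(\<lambda>p. tensor_ract A B \<phi> p a) \<in> additive_maps T T"
    and "\<lbrakk>x \<in> carrier A; y \<in> carrier A\<rbrakk> \<Longrightarrow> tensor_ract A B \<phi> (pure x y) a = pure x (y \<otimes>\<^bsub>A\<^esub> a)"
  unfolding tensor_ract_def
  by (rule tensor_map_additive[OF id_additive mult_right_additive[OF assms]];
      simp add: A.m_assoc assms)+

lemmas tensor_lact_closed [simp] = additive_maps_closed[OF tensor_lact_additive(1)]
lemmas tensor_ract_closed [simp] = additive_maps_closed[OF tensor_ract_additive(1)]

lemma tensor_lact_mult: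
  assumes "a \<in> carrier A" "a' \<in> carrier A" "p \<in> carrier T"
  shows "tensor_lact A B \<phi> (a \<otimes>\<^bsub>A\<^esub> a') p = tensor_lact A B \<phi> a (tensor_lact A B \<phi> a' p)"
  by (rule tensor_additive_eq[OF T.abelian_group_axioms tensor_lact_additive(1)
        additive_maps_compose[OF tensor_lact_additive(1)[OF assms(2)] tensor_lact_additive(1)[OF assms(1)]]
        _ assms(3)])
    (use assms in \<open>simp_all add: tensor_lact_additive(2) A.m_assoc\<close>)

lemma tensor_lact_ract:
  assumes "a \<in> carrier A" "a' \<in> carrier A" "p \<in> carrier T"
  shows "tensor_ract A B \<phi> (tensor_lact A B \<phi> a p) a' = tensor_lact A B \<phi> a (tensor_ract A B \<phi> p a')"
  by (rule tensor_additive_eq[OF T.abelian_group_axioms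
        additive_maps_compose[OF tensor_lact_additive(1)[OF assms(1)] tensor_ract_additive(1)[OF assms(2)]]
        additive_maps_compose[OF tensor_ract_additive(1)[OF assms(2)] tensor_lact_additive(1)[OF assms(1)]]
        _ assms(3)])
    (use assms in \<open>simp_all add: tensor_lact_additive(2) tensor_ract_additive(2)\<close>)

text \<open>Left \<open>B\<close>-linearity of \<alpha> makes (x, y) \<mapsto> x \<alpha>(y)
  balanced. Hence \<open>pairing_rep\<close> is constant on each coset, the image of a coset is a
  singleton, and \<open>the_elem\<close> picks a meaningful value.\<close>

lemma pairing_additive:
  assumes "\<alpha> \<in> additive_maps A A"
    and "\<And>b y. \<lbrakk>b \<in> carrier B; y \<in> carrier A\<rbrakk> \<Longrightarrow> \<alpha> (\<phi> b \<otimes>\<^bsub>A\<^esub> y) = \<phi> b \<otimes>\<^bsub>A\<^esub> \<alpha> y"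
  shows "(\<lambda>p. pairing A p \<alpha>) \<in> additive_maps T A"
    and "\<lbrakk>x \<in> carrier A; y \<in> carrier A\<rbrakk> \<Longrightarrow> pairing A (pure x y) \<alpha> = x \<otimes>\<^bsub>A\<^esub> \<alpha> y"
proof -
  note closed [simp] = additive_maps_closed[OF assms(1)]
  let ?g = "\<lambda>z. fst z \<otimes>\<^bsub>A\<^esub> \<alpha> (snd z)"
  have "?g \<in> carrier A \<times> carrier A \<rightarrow> carrier A"
    by auto
  note h = frag_sum_hom[OF A.abelian_group_axioms this, folded pairing_rep_def]
  have bal: "balanced A (\<lambda>x y. x \<otimes>\<^bsub>A\<^esub> \<alpha> y)"
    unfolding balanced_def using assms(2)
    by (simp add: A.l_distr A.r_distr A.m_assoc additive_maps_add[OF assms(1)])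
  have cls: "pairing A (cls u) \<alpha> = pairing_rep A \<alpha> u"
    if u: "Poly_Mapping.keys u \<subseteq> carrier A \<times> carrier A" for u
  proof -
    have "pairing_rep A \<alpha> w = pairing_rep A \<alpha> u" if "w \<in> cls u" for w
      by (rule balanced_constant_on_coset[OF A.abelian_group_axioms h(1) bal _ that u]) (simp add: h(2))
    then have "pairing_rep A \<alpha> ` cls u = (\<lambda>w. pairing_rep A \<alpha> u) ` cls u"
      by (intro image_cong refl)
    moreover have "u \<in> cls u"
      using u Fr.rcos_self[OF _ subgroup_Rel] by simp
    ultimately have "pairing_rep A \<alpha> ` cls u = {pairing_rep A \<alpha> u}"
      by auto
    then show ?thesis
      by (simp add: pairing_def)
  qed
  show "(\<lambda>p. pairing A p \<alpha>) \<in> additive_maps T A"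
    using h(1) cls by (rule additive_maps_cls)
  show "pairing A (pure x y) \<alpha> = x \<otimes>\<^bsub>A\<^esub> \<alpha> y" if "x \<in> carrier A" "y \<in> carrier A"
    using that h(2)[of "(x, y)"] by (simp add: pure_def cls)
qed

end

section \<open>Modules over the centralizer\<close>

locale tower = ring_extension A B \<phi> + C: ring C
  for A :: "('a, 'k) ring_scheme" and B :: "('b, 'l) ring_scheme" and \<phi> :: "'b \<Rightarrow> 'a"
    and C :: "('c, 'm) ring_scheme" +
  fixes \<psi> :: "'c \<Rightarrow> 'b"
  assumes hom': "\<psi> \<in> ring_hom C B"
begin

abbreviation "V \<equiv> centralizer A C \<phi> \<psi>"
abbreviation "P \<equiv> tensor_centralizer A B C \<phi> \<psi>"
abbreviation "E \<equiv> bimodule_End A B C \<phi> \<psi>"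
abbreviation "D \<equiv> left_dual V P (tensor_lact A B \<phi>)"

lemma hom_closed' [simp]: "c \<in> carrier C \<Longrightarrow> \<psi> c \<in> carrier B"
  using hom' by (rule ring_hom_closed)

section \<open>The centralizer as a ring\<close>

lemma V_iff: "v \<in> carrier V \<longleftrightarrow>
    v \<in> carrier A \<and> (\<forall>c\<in>carrier C. \<phi> (\<psi> c) \<otimes>\<^bsub>A\<^esub> v = v \<otimes>\<^bsub>A\<^esub> \<phi> (\<psi> c))"
  by (simp add: centralizer_def)

lemma V_ops: "x \<oplus>\<^bsub>V\<^esub> y = x \<oplus>\<^bsub>A\<^esub> y" "x \<otimes>\<^bsub>V\<^esub> y = x \<otimes>\<^bsub>A\<^esub> y" "\<zero>\<^bsub>V\<^esub> = \<zero>\<^bsub>A\<^esub>"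
  by (simp_all add: centralizer_def)

lemma update_carrier_V: "A\<lparr>carrier := carrier V\<rparr> = V"
  by (simp add: centralizer_def)

lemma V_memI:
  assumes "v \<in> carrier A"
    and "\<And>c. c \<in> carrier C \<Longrightarrow> \<phi> (\<psi> c) \<otimes>\<^bsub>A\<^esub> v = v \<otimes>\<^bsub>A\<^esub> \<phi> (\<psi> c)"
  shows "v \<in> carrier V"
  using assms by (simp add: V_iff)

lemma V_commute: "\<lbrakk>v \<in> carrier V; c \<in> carrier C\<rbrakk> \<Longrightarrow> \<phi> (\<psi> c) \<otimes>\<^bsub>A\<^esub> v = v \<otimes>\<^bsub>A\<^esub> \<phi> (\<psi> c)"
  by (simp add: V_iff)

lemma V_closed [simp]: "v \<in> carrier V \<Longrightarrow> v \<in> carrier A"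
  by (simp add: V_iff)

lemma ring_centralizer: "ring V"
proof -
  have "subring (carrier V) A"
  proof (rule A.subringI)
    fix v w assume vw: "v \<in> carrier V" "w \<in> carrier V"
    show "v \<otimes>\<^bsub>A\<^esub> w \<in> carrier V"
    proof (rule V_memI)
      fix c assume c: "c \<in> carrier C"
      have closed: "v \<in> carrier A" "w \<in> carrier A" "\<phi> (\<psi> c) \<in> carrier A"
        using vw c by simp_all
      have "\<phi> (\<psi> c) \<otimes>\<^bsub>A\<^esub> (v \<otimes>\<^bsub>A\<^esub> w) = \<phi> (\<psi> c) \<otimes>\<^bsub>A\<^esub> v \<otimes>\<^bsub>A\<^esub> w"
        using closed by (simp add: A.m_assoc)
      also have "\<dots> = v \<otimes>\<^bsub>A\<^esub> (\<phi> (\<psi> c) \<otimes>\<^bsub>A\<^esub> w)"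
        using vw c closed by (simp add: V_commute A.m_assoc[of v])
      also have "\<dots> = v \<otimes>\<^bsub>A\<^esub> w \<otimes>\<^bsub>A\<^esub> \<phi> (\<psi> c)"
        using vw c closed by (simp add: V_commute A.m_assoc)
      finally show "\<phi> (\<psi> c) \<otimes>\<^bsub>A\<^esub> (v \<otimes>\<^bsub>A\<^esub> w) = v \<otimes>\<^bsub>A\<^esub> w \<otimes>\<^bsub>A\<^esub> \<phi> (\<psi> c)" .
    qed (use vw in simp)
  qed (auto intro!: V_memI simp: V_commute A.l_minus A.r_minus A.l_distr A.r_distr)
  from A.subring_is_ring[OF this] show ?thesis
    by (simp only: update_carrier_V)
qed

sublocale V: ring V
  by (rule ring_centralizer)

section \<open>The tensors that commute with \<open>C\<close>\<close>

lemma P_iff: "p \<in> carrier P \<longleftrightarrow> p \<in> carrier T \<and>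
    (\<forall>c\<in>carrier C. tensor_lact A B \<phi> (\<phi> (\<psi> c)) p = tensor_ract A B \<phi> p (\<phi> (\<psi> c)))"
  by (simp add: tensor_centralizer_def)

lemma P_ops: "p \<oplus>\<^bsub>P\<^esub> q = p \<oplus>\<^bsub>T\<^esub> q" "\<zero>\<^bsub>P\<^esub> = \<zero>\<^bsub>T\<^esub>"
  by (simp_all add: tensor_centralizer_def)

lemma P_memI:
  assumes "p \<in> carrier T"
    and "\<And>c. c \<in> carrier C \<Longrightarrow> tensor_lact A B \<phi> (\<phi> (\<psi> c)) p = tensor_ract A B \<phi> p (\<phi> (\<psi> c))"
  shows "p \<in> carrier P"
  using assms by (simp add: P_iff)

lemma P_commute: "\<lbrakk>p \<in> carrier P; c \<in> carrier C\<rbrakk> \<Longrightarrow>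
    tensor_lact A B \<phi> (\<phi> (\<psi> c)) p = tensor_ract A B \<phi> p (\<phi> (\<psi> c))"
  by (simp add: P_iff)

lemma P_closed [simp]: "p \<in> carrier P \<Longrightarrow> p \<in> carrier T"
  by (simp add: P_iff)

lemma P_add_closed [simp]: "\<lbrakk>p \<in> carrier P; q \<in> carrier P\<rbrakk> \<Longrightarrow> p \<oplus>\<^bsub>T\<^esub> q \<in> carrier P"
  by (rule P_memI)
    (simp_all add: P_commute additive_maps_add[OF tensor_lact_additive(1)]
      additive_maps_add[OF tensor_ract_additive(1)])

lemma P_zero_closed [simp]: "\<zero>\<^bsub>T\<^esub> \<in> carrier P"
  using additive_maps_zero[OF T.abelian_group_axioms T.abelian_group_axioms tensor_lact_additive(1)]
    additive_maps_zero[OF T.abelian_group_axioms T.abelian_group_axioms tensor_ract_additive(1)]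
  by (intro P_memI) simp_all

text \<open>Since v commutes with c, one has c(vp) = v(cp) = v(pc) = (vp)c.\<close>

lemma P_lact_closed [simp]:
  assumes "v \<in> carrier V" "p \<in> carrier P"
  shows "tensor_lact A B \<phi> v p \<in> carrier P"
proof (rule P_memI)
  fix c assume c: "c \<in> carrier C"
  have "tensor_lact A B \<phi> (\<phi> (\<psi> c)) (tensor_lact A B \<phi> v p) = tensor_lact A B \<phi> v (tensor_lact A B \<phi> (\<phi> (\<psi> c)) p)"
    using assms c by (simp add: V_commute flip: tensor_lact_mult)
  then show "tensor_lact A B \<phi> (\<phi> (\<psi> c)) (tensor_lact A B \<phi> v p) =
      tensor_ract A B \<phi> (tensor_lact A B \<phi> v p) (\<phi> (\<psi> c))"
    using assms c by (simp add: P_commute tensor_lact_ract)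
qed (use assms in simp)

section \<open>The bimodule endomorphisms as a right module\<close>

lemma E_iff: "\<alpha> \<in> carrier E \<longleftrightarrow> \<alpha> \<in> additive_maps A A \<and> \<alpha> \<in> extensional (carrier A) \<and>
    (\<forall>b\<in>carrier B. \<forall>a\<in>carrier A. \<alpha> (\<phi> b \<otimes>\<^bsub>A\<^esub> a) = \<phi> b \<otimes>\<^bsub>A\<^esub> \<alpha> a) \<and>
    (\<forall>a\<in>carrier A. \<forall>c\<in>carrier C. \<alpha> (a \<otimes>\<^bsub>A\<^esub> \<phi> (\<psi> c)) = \<alpha> a \<otimes>\<^bsub>A\<^esub> \<phi> (\<psi> c))"
  by (auto simp: bimodule_End_def)

lemma E_closed [simp]: "\<lbrakk>\<alpha> \<in> carrier E; a \<in> carrier A\<rbrakk> \<Longrightarrow> \<alpha> a \<in> carrier A"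
  by (auto simp: E_iff intro: additive_maps_closed)

lemma E_add: "\<lbrakk>\<alpha> \<in> carrier E; a \<in> carrier A; a' \<in> carrier A\<rbrakk> \<Longrightarrow> \<alpha> (a \<oplus>\<^bsub>A\<^esub> a') = \<alpha> a \<oplus>\<^bsub>A\<^esub> \<alpha> a'"
  by (auto simp: E_iff intro: additive_maps_add)

lemma E_left: "\<lbrakk>\<alpha> \<in> carrier E; b \<in> carrier B; a \<in> carrier A\<rbrakk> \<Longrightarrow>
    \<alpha> (\<phi> b \<otimes>\<^bsub>A\<^esub> a) = \<phi> b \<otimes>\<^bsub>A\<^esub> \<alpha> a"
  by (simp add: E_iff)

lemma E_right: "\<lbrakk>\<alpha> \<in> carrier E; a \<in> carrier A; c \<in> carrier C\<rbrakk> \<Longrightarrow>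
    \<alpha> (a \<otimes>\<^bsub>A\<^esub> \<phi> (\<psi> c)) = \<alpha> a \<otimes>\<^bsub>A\<^esub> \<phi> (\<psi> c)"
  by (simp add: E_iff)

lemma E_subset: "carrier E \<subseteq> carrier A \<rightarrow>\<^sub>E carrier A"
  by (auto simp: E_iff PiE_def dest: additive_maps_closed)

lemma restrict_in_E:
  assumes "f \<in> additive_maps A A"
    and "\<And>b a. \<lbrakk>b \<in> carrier B; a \<in> carrier A\<rbrakk> \<Longrightarrow> f (\<phi> b \<otimes>\<^bsub>A\<^esub> a) = \<phi> b \<otimes>\<^bsub>A\<^esub> f a"
    and "\<And>a c. \<lbrakk>a \<in> carrier A; c \<in> carrier C\<rbrakk> \<Longrightarrow> f (a \<otimes>\<^bsub>A\<^esub> \<phi> (\<psi> c)) = f a \<otimes>\<^bsub>A\<^esub> \<phi> (\<psi> c)"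
  shows "(\<lambda>a\<in>carrier A. f a) \<in> carrier E"
  using assms additive_maps_closed[OF assms(1)] additive_maps_add[OF assms(1)]
  by (auto simp: E_iff intro!: additive_mapsI)

text \<open>Right \<open>C\<close>-linearity is where v must centralize \<open>C\<close>:
  \<alpha>(ac)v = \<alpha>(a)cv = \<alpha>(a)vc.\<close>

lemma End_ract_closed:
  assumes "\<alpha> \<in> carrier E" "v \<in> carrier V"
  shows "(\<lambda>a\<in>carrier A. \<alpha> a \<otimes>\<^bsub>A\<^esub> v) \<in> carrier E"
  using assms
  by (intro restrict_in_E additive_mapsI) (simp_all add: E_add E_left E_right V_commute A.l_distr A.m_assoc)

lemma E_plus_closed:
  assumes "\<alpha> \<in> carrier E" "\<beta> \<in> carrier E"
  shows "(\<lambda>a\<in>carrier A. \<alpha> a \<oplus>\<^bsub>A\<^esub> \<beta> a) \<in> carrier E"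
  using assms
  by (intro restrict_in_E additive_mapsI)
    (simp_all add: E_add E_left E_right A.l_distr A.r_distr A.a_ac)

lemma E_zero_closed: "(\<lambda>a\<in>carrier A. \<zero>\<^bsub>A\<^esub>) \<in> carrier E"
  by (intro restrict_in_E additive_mapsI) auto

lemma abelian_group_End: "abelian_group E"
proof -
  have "(\<lambda>a\<in>carrier A. \<ominus>\<^bsub>A\<^esub> \<alpha> a) \<in> carrier E" if "\<alpha> \<in> carrier E" for \<alpha>
    using that
    by (intro restrict_in_E additive_mapsI)
      (simp_all add: E_add E_left E_right A.l_minus A.r_minus A.minus_add)
  then show ?thesis
    using abelian_group_pointwise[OF A.abelian_group_axioms E_subset E_zero_closed E_plus_closed]
    by (simp add: bimodule_End_def)
qed

lemma right_module_End: "right_module V E (End_ract A)"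
proof -
  have "right_module (A\<lparr>carrier := carrier V\<rparr>) E (\<lambda>f v. \<lambda>x\<in>carrier A. f x \<otimes>\<^bsub>A\<^esub> v)"
    using abelian_group_End V.ring_axioms E_subset
    by (intro right_module_pointwise A.ring_axioms End_ract_closed)
      (auto simp: update_carrier_V bimodule_End_def[of A B C])
  then show ?thesis
    by (simp only: End_ract_def[abs_def] update_carrier_V)
qed

section \<open>The left dual as a right module\<close>

lemma D_iff: "F \<in> carrier D \<longleftrightarrow> F \<in> additive_maps P V \<and> F \<in> extensional (carrier P) \<and>
    (\<forall>v\<in>carrier V. \<forall>p\<in>carrier P. F (tensor_lact A B \<phi> v p) = v \<otimes>\<^bsub>V\<^esub> F p)"
  by (auto simp: left_dual_def)

lemma restrict_in_D:
  assumes "\<And>p. p \<in> carrier P \<Longrightarrow> f p \<in> carrier V"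
    and "\<And>p q. \<lbrakk>p \<in> carrier P; q \<in> carrier P\<rbrakk> \<Longrightarrow> f (p \<oplus>\<^bsub>P\<^esub> q) = f p \<oplus>\<^bsub>V\<^esub> f q"
    and "\<And>v p. \<lbrakk>v \<in> carrier V; p \<in> carrier P\<rbrakk> \<Longrightarrow> f (tensor_lact A B \<phi> v p) = v \<otimes>\<^bsub>V\<^esub> f p"
  shows "(\<lambda>p\<in>carrier P. f p) \<in> carrier D"
  using assms by (auto simp: D_iff P_ops intro!: additive_mapsI)

lemma D_closed: "\<lbrakk>F \<in> carrier D; p \<in> carrier P\<rbrakk> \<Longrightarrow> F p \<in> carrier V"
  by (auto simp: D_iff intro: additive_maps_closed)

lemma D_add: "\<lbrakk>F \<in> carrier D; p \<in> carrier P; q \<in> carrier P\<rbrakk> \<Longrightarrow> F (p \<oplus>\<^bsub>P\<^esub> q) = F p \<oplus>\<^bsub>V\<^esub> F q"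
  by (auto simp: D_iff intro: additive_maps_add)

lemma D_lact: "\<lbrakk>F \<in> carrier D; v \<in> carrier V; p \<in> carrier P\<rbrakk> \<Longrightarrow>
    F (tensor_lact A B \<phi> v p) = v \<otimes>\<^bsub>V\<^esub> F p"
  by (simp add: D_iff)

lemma abelian_group_dual: "abelian_group D"
proof -
  have "carrier D \<subseteq> carrier P \<rightarrow>\<^sub>E carrier V"
    by (auto simp: D_iff PiE_def dest: additive_maps_closed)
  moreover have "(\<lambda>p\<in>carrier P. \<zero>\<^bsub>V\<^esub>) \<in> carrier D"
    by (rule restrict_in_D) simp_all
  moreover have "(\<lambda>p\<in>carrier P. F p \<oplus>\<^bsub>V\<^esub> G p) \<in> carrier D"
    if "F \<in> carrier D" "G \<in> carrier D" for F G
    using that by (intro restrict_in_D) (simp_all add: D_closed D_add D_lact V.a_ac V.r_distr)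
  moreover have "(\<lambda>p\<in>carrier P. \<ominus>\<^bsub>V\<^esub> F p) \<in> carrier D" if "F \<in> carrier D" for F
    using that by (intro restrict_in_D) (simp_all add: D_closed D_add D_lact V.minus_add V.r_minus)
  ultimately show ?thesis
    using abelian_group_pointwise[OF V.abelian_group_axioms, of "carrier D" "carrier P"]
    by (simp add: left_dual_def)
qed

lemma right_module_dual: "right_module V D (left_dual_ract V P)"
proof -
  have "(\<lambda>p\<in>carrier P. F p \<otimes>\<^bsub>V\<^esub> v) \<in> carrier D" if "F \<in> carrier D" "v \<in> carrier V" for F v
    using that by (intro restrict_in_D) (simp_all add: D_closed D_add D_lact V.l_distr V.m_assoc)
  moreover have "carrier D \<subseteq> carrier P \<rightarrow>\<^sub>E carrier A"
    using D_closed V_closed by (auto simp: D_iff PiE_def)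
  ultimately have "right_module (A\<lparr>carrier := carrier V\<rparr>) D (\<lambda>F v. \<lambda>p\<in>carrier P. F p \<otimes>\<^bsub>A\<^esub> v)"
    using abelian_group_dual V.ring_axioms
    by (intro right_module_pointwise A.ring_axioms) (auto simp: update_carrier_V V_ops left_dual_def[of V P])
  then show ?thesis
    by (simp only: left_dual_ract_def[abs_def] update_carrier_V V_ops)
qed

section \<open>Linearity of the pairing in both arguments\<close>

lemma pairing_additive_End: "\<alpha> \<in> carrier E \<Longrightarrow> (\<lambda>p. pairing A p \<alpha>) \<in> additive_maps T A"
  by (rule pairing_additive) (auto simp: E_iff)

lemma pairing_pure [simp]:
  "\<lbrakk>\<alpha> \<in> carrier E; x \<in> carrier A; y \<in> carrier A\<rbrakk> \<Longrightarrow> pairing A (pure x y) \<alpha> = x \<otimes>\<^bsub>A\<^esub> \<alpha> y"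
  by (rule pairing_additive) (auto simp: E_iff)

lemma pairing_closed [simp]:
  "\<lbrakk>p \<in> carrier T; \<alpha> \<in> carrier E\<rbrakk> \<Longrightarrow> pairing A p \<alpha> \<in> carrier A"
  using additive_maps_closed[OF pairing_additive_End] .

lemma pairing_lact:
  assumes "a \<in> carrier A" "p \<in> carrier T" "\<alpha> \<in> carrier E"
  shows "pairing A (tensor_lact A B \<phi> a p) \<alpha> = a \<otimes>\<^bsub>A\<^esub> pairing A p \<alpha>"
  by (rule tensor_additive_eq[OF A.abelian_group_axioms
        additive_maps_compose[OF tensor_lact_additive(1)[OF assms(1)] pairing_additive_End[OF assms(3)]]
        additive_maps_compose[OF pairing_additive_End[OF assms(3)] mult_left_additive[OF assms(1)]]
        _ assms(2)])
    (use assms in \<open>simp add: tensor_lact_additive(2) A.m_assoc\<close>)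

lemma pairing_ract:
  assumes "c \<in> carrier C" "p \<in> carrier T" "\<alpha> \<in> carrier E"
  shows "pairing A (tensor_ract A B \<phi> p (\<phi> (\<psi> c))) \<alpha> = pairing A p \<alpha> \<otimes>\<^bsub>A\<^esub> \<phi> (\<psi> c)"
proof -
  have c: "\<phi> (\<psi> c) \<in> carrier A" using assms(1) by simp
  show ?thesis
    by (rule tensor_additive_eq[OF A.abelian_group_axioms
          additive_maps_compose[OF tensor_ract_additive(1)[OF c] pairing_additive_End[OF assms(3)]]
          additive_maps_compose[OF pairing_additive_End[OF assms(3)] mult_right_additive[OF c]]
          _ assms(2)])
      (use assms in \<open>simp add: tensor_ract_additive(2) A.m_assoc E_right\<close>)
qed

text \<open>The chain is c\<langle>p, \<alpha>\<rangle> = \<langle>cp, \<alpha>\<rangle> =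
  \<langle>pc, \<alpha>\<rangle> = \<langle>p, \<alpha>\<rangle>c, where the last equality rests on
  right \<open>C\<close>-linearity of \<alpha>.\<close>

lemma pairing_in_centralizer [simp]:
  assumes "p \<in> carrier P" "\<alpha> \<in> carrier E"
  shows "pairing A p \<alpha> \<in> carrier V"
  using assms by (intro V_memI) (simp_all add: P_commute flip: pairing_ract pairing_lact)

text \<open>This is what allows a finite sum in \<open>E\<close> to be paired term by term.\<close>

lemma pairing_plus:
  assumes "p \<in> carrier T" "\<alpha> \<in> carrier E" "\<beta> \<in> carrier E"
  shows "pairing A p (\<alpha> \<oplus>\<^bsub>E\<^esub> \<beta>) = pairing A p \<alpha> \<oplus>\<^bsub>A\<^esub> pairing A p \<beta>"
proof -
  have plus: "\<alpha> \<oplus>\<^bsub>E\<^esub> \<beta> = (\<lambda>a\<in>carrier A. \<alpha> a \<oplus>\<^bsub>A\<^esub> \<beta> a)"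
    by (simp add: bimodule_End_def)
  note sum = E_plus_closed[OF assms(2,3)]
  have "(\<lambda>p. pairing A p \<alpha> \<oplus>\<^bsub>A\<^esub> pairing A p \<beta>) \<in> additive_maps T A"
    using assms by (intro additive_mapsI)
      (simp_all add: additive_maps_add[OF pairing_additive_End] A.a_ac)
  then show ?thesis
    unfolding plus
    by (rule tensor_additive_eq[OF A.abelian_group_axioms pairing_additive_End[OF sum] _ _ assms(1)])
      (use assms sum in \<open>simp add: A.r_distr\<close>)
qed

lemma pairing_End_ract:
  assumes "p \<in> carrier T" "\<alpha> \<in> carrier E" "v \<in> carrier V"
  shows "pairing A p (End_ract A \<alpha> v) = pairing A p \<alpha> \<otimes>\<^bsub>A\<^esub> v"
  unfolding End_ract_def
  by (rule tensor_additive_eq[OF A.abelian_group_axioms pairing_additive_End[OF End_ract_closed[OF assms(2,3)]]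
        additive_maps_compose[OF pairing_additive_End[OF assms(2)] mult_right_additive[OF V_closed[OF assms(3)]]]
        _ assms(1)])
    (use assms End_ract_closed[OF assms(2,3)] in \<open>simp add: A.m_assoc\<close>)

section \<open>Dual bases\<close>

text \<open>
  \<open>u i\<close> corresponds to the component in \<open>H\<close> of the standard basis vector \<open>e i\<close> of
  \<open>A\<^sup>N = H \<oplus> K\<close>; it commutes with \<open>C\<close> because \<open>e i\<close> does and the decomposition is unique.
\<close>

lemma dual_basis:
  assumes "right_depth_three A B C \<phi> \<psi>"
  obtains N :: nat and \<gamma> u where "\<And>i. i < N \<Longrightarrow> \<gamma> i \<in> carrier E" "\<And>i. i < N \<Longrightarrow> u i \<in> carrier P"
    "\<And>p. p \<in> carrier T \<Longrightarrow> p = (\<Oplus>\<^bsub>T\<^esub>i\<in>{..<N}. tensor_lact A B \<phi> (pairing A p (\<gamma> i)) (u i))"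
proof -
  obtain N H h where "direct_summand A C (power_group N A) (\<lambda>a x. \<lambda>i\<in>{..<N}. a \<otimes>\<^bsub>A\<^esub> x i)
      (\<lambda>x c. \<lambda>i\<in>{..<N}. x i \<otimes>\<^bsub>A\<^esub> \<phi> (\<psi> c)) H"
    and h: "h \<in> bimodule_isos A C T (tensor_lact A B \<phi>) (\<lambda>p c. tensor_ract A B \<phi> p (\<phi> (\<psi> c)))
      ((power_group N A)\<lparr>carrier := H\<rparr>) (\<lambda>a x. \<lambda>i\<in>{..<N}. a \<otimes>\<^bsub>A\<^esub> x i)
      (\<lambda>x c. \<lambda>i\<in>{..<N}. x i \<otimes>\<^bsub>A\<^esub> \<phi> (\<psi> c))"
    using assms unfolding right_depth_three_def Let_def by blast
  define M where "M = power_group N A"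
  define lact where "lact = (\<lambda>a (x :: nat \<Rightarrow> 'a). \<lambda>i\<in>{..<N}. a \<otimes>\<^bsub>A\<^esub> x i)"
  define ract where "ract = (\<lambda>(x :: nat \<Rightarrow> 'a) c. \<lambda>i\<in>{..<N}. x i \<otimes>\<^bsub>A\<^esub> \<phi> (\<psi> c))"
  have M_carrier: "carrier M = {..<N} \<rightarrow>\<^sub>E carrier A"
    and M_add: "x \<oplus>\<^bsub>M\<^esub> y = (\<lambda>i\<in>{..<N}. x i \<oplus>\<^bsub>A\<^esub> y i)" for x y
    by (simp_all add: M_def power_group_def)
  have "abelian_group M"
    unfolding M_def power_group_def
    by (rule abelian_group_pointwise[OF A.abelian_group_axioms order_refl])
      (auto simp: PiE_def)
  then interpret M: abelian_group M .
  from \<open>direct_summand _ _ _ _ _ H\<close> obtain K where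
    H: "subbimodule A C M lact ract H" and K: "subbimodule A C M lact ract K"
    and HK: "H <+>\<^bsub>M\<^esub> K = carrier M" "H \<inter> K = {\<zero>\<^bsub>M\<^esub>}"
    unfolding direct_summand_def M_def lact_def ract_def by blast
  interpret H: additive_subgroup H M using H by (simp add: subbimodule_def)
  interpret K: additive_subgroup K M using K by (simp add: subbimodule_def)
  have lact_sub: "\<lbrakk>a \<in> carrier A; x \<in> H\<rbrakk> \<Longrightarrow> lact a x \<in> H" "\<lbrakk>a \<in> carrier A; x \<in> K\<rbrakk> \<Longrightarrow> lact a x \<in> K"
    and ract_sub: "\<lbrakk>c \<in> carrier C; x \<in> H\<rbrakk> \<Longrightarrow> ract x c \<in> H" "\<lbrakk>c \<in> carrier C; x \<in> K\<rbrakk> \<Longrightarrow> ract x c \<in> K"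
    for a x c
    using H K by (simp_all add: subbimodule_def)
  \<comment> \<open>The difference x - x' = k' - k lies in both \<open>H\<close> and
    \<open>K\<close>, hence is zero.\<close>
  have unique: "x = x'" if "x \<in> H" "x' \<in> H" "k \<in> K" "k' \<in> K" "x \<oplus>\<^bsub>M\<^esub> k = x' \<oplus>\<^bsub>M\<^esub> k'" for x x' k k'
  proof -
    have [simp]: "x \<in> carrier M" "x' \<in> carrier M" "k \<in> carrier M" "k' \<in> carrier M"
      using that by (auto intro: H.a_Hcarr K.a_Hcarr)
    have "x \<ominus>\<^bsub>M\<^esub> x' = \<ominus>\<^bsub>M\<^esub> x' \<oplus>\<^bsub>M\<^esub> (x \<oplus>\<^bsub>M\<^esub> k \<ominus>\<^bsub>M\<^esub> k)"
      by (simp add: M.minus_eq M.a_assoc M.r_neg M.r_neg2 M.a_comm[of x])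
    also have "\<dots> = k' \<ominus>\<^bsub>M\<^esub> k"
      by (simp add: that(5) M.minus_eq M.a_assoc M.r_neg1)
    finally have "x \<ominus>\<^bsub>M\<^esub> x' = k' \<ominus>\<^bsub>M\<^esub> k" .
    moreover have "x \<ominus>\<^bsub>M\<^esub> x' \<in> H" "k' \<ominus>\<^bsub>M\<^esub> k \<in> K"
      using that by (simp_all add: M.minus_eq H.a_closed K.a_closed H.a_inv_closed K.a_inv_closed)
    ultimately have "x \<ominus>\<^bsub>M\<^esub> x' = \<zero>\<^bsub>M\<^esub>"
      using HK(2) by auto
    then show ?thesis
      by (simp add: M.minus_eq_zero_iff)
  qed
  have lact_add: "lact a (x \<oplus>\<^bsub>M\<^esub> y) = lact a x \<oplus>\<^bsub>M\<^esub> lact a y"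
    if "a \<in> carrier A" "x \<in> carrier M" "y \<in> carrier M" for a x y
    using that by (auto simp: lact_def M_add M_carrier PiE_def Pi_def A.r_distr)
  have ract_add: "ract (x \<oplus>\<^bsub>M\<^esub> y) c = ract x c \<oplus>\<^bsub>M\<^esub> ract y c"
    if "c \<in> carrier C" "x \<in> carrier M" "y \<in> carrier M" for c x y
    using that by (auto simp: ract_def M_add M_carrier PiE_def Pi_def A.l_distr)
  have lact_closed: "lact a x \<in> carrier M" if "a \<in> carrier A" "x \<in> carrier M" for a x
    using that by (auto simp: lact_def M_carrier)
  define e where "e i = (\<lambda>j\<in>{..<N}. if j = i then \<one>\<^bsub>A\<^esub> else \<zero>\<^bsub>A\<^esub>)" for i
  have e: "e i \<in> carrier M" for i
    by (simp add: e_def M_carrier)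
  have "\<exists>x\<in>H. \<exists>k\<in>K. e i = x \<oplus>\<^bsub>M\<^esub> k" for i
    using e[of i] unfolding HK(1)[symmetric] set_add_def' by blast
  then obtain x k where x: "\<And>i. x i \<in> H" and k: "\<And>i. k i \<in> K" and e_eq: "\<And>i. e i = x i \<oplus>\<^bsub>M\<^esub> k i"
    by metis
  have xk: "x i \<in> carrier M" "k i \<in> carrier M" for i
    using x k by (auto intro: H.a_Hcarr K.a_Hcarr)
  have h_hom: "h (p \<oplus>\<^bsub>T\<^esub> q) = h p \<oplus>\<^bsub>M\<^esub> h q" if "p \<in> carrier T" "q \<in> carrier T" for p q
    using h that by (simp add: bimodule_isos_def additive_maps_def hom_def M_def)
  have h_H: "h p \<in> H" if "p \<in> carrier T" for p
    using h that by (auto simp: bimodule_isos_def additive_maps_def hom_def)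
  have h_lact: "h (tensor_lact A B \<phi> a p) = lact a (h p)" if "a \<in> carrier A" "p \<in> carrier T" for a p
    using h that by (simp add: bimodule_isos_def lact_def)
  have h_ract: "h (tensor_ract A B \<phi> p (\<phi> (\<psi> c))) = ract (h p) c" if "c \<in> carrier C" "p \<in> carrier T" for c p
    using h that by (simp add: bimodule_isos_def ract_def)
  have h_bij: "bij_betw h (carrier T) H"
    using h by (simp add: bimodule_isos_def)
  then have h_inj: "p = q" if "h p = h q" "p \<in> carrier T" "q \<in> carrier T" for p q
    using that by (auto simp: bij_betw_def dest: inj_onD)
  have h_add: "h \<in> additive_maps T M"
    using h_hom h_H by (auto intro!: additive_mapsI H.a_Hcarr)
  have eval: "(\<lambda>x. x j) \<in> additive_maps M A" if "j < N" for j
    using that by (intro additive_mapsI) (auto simp: M_carrier M_add)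
  have h_eval: "(\<lambda>p. h p j) \<in> additive_maps T A" if "j < N" for j
    using additive_maps_compose[OF h_add eval[OF that]] .

  have "\<exists>p\<in>carrier T. h p = x i" for i
    using h_bij x[of i] by (metis bij_betw_imp_surj_on imageE)
  then obtain u where u: "\<And>i. u i \<in> carrier T" and hu: "\<And>i. h (u i) = x i"
    by metis
  have uP: "u i \<in> carrier P" for i
  proof (rule P_memI[OF u])
    fix c assume c: "c \<in> carrier C"
    have "lact (\<phi> (\<psi> c)) (x i) \<oplus>\<^bsub>M\<^esub> lact (\<phi> (\<psi> c)) (k i) = lact (\<phi> (\<psi> c)) (e i)"
      using c xk by (simp add: lact_add e_eq)
    also have "\<dots> = ract (e i) c"
      using c by (auto simp: lact_def ract_def e_def)
    also have "\<dots> = ract (x i) c \<oplus>\<^bsub>M\<^esub> ract (k i) c"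
      using c xk by (simp add: ract_add e_eq)
    finally have "lact (\<phi> (\<psi> c)) (x i) = ract (x i) c"
      by (rule unique[rotated -1]) (use c x k in \<open>simp_all add: lact_sub ract_sub\<close>)
    then show "tensor_lact A B \<phi> (\<phi> (\<psi> c)) (u i) = tensor_ract A B \<phi> (u i) (\<phi> (\<psi> c))"
      using c u by (intro h_inj) (simp_all add: h_lact h_ract hu)
  qed

  \<comment> \<open>By left \<open>A\<close>-linearity of h, the values at 1 \<otimes> a determine
    the i-th coordinate on all pure tensors; this is how the coordinate becomes a pairing.\<close>
  define \<gamma> where "\<gamma> i = (\<lambda>a\<in>carrier A. h (pure \<one>\<^bsub>A\<^esub> a) i)" for i
  have pure_lact: "pure a y = tensor_lact A B \<phi> a (pure \<one>\<^bsub>A\<^esub> y)" if "a \<in> carrier A" "y \<in> carrier A" for a y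
    using that by (simp add: tensor_lact_additive(2))
  have h_pure: "h (pure a y) i = a \<otimes>\<^bsub>A\<^esub> h (pure \<one>\<^bsub>A\<^esub> y) i"
    if "a \<in> carrier A" "y \<in> carrier A" "i < N" for a y i
    using that by (subst pure_lact) (simp_all add: h_lact lact_def)
  have \<gamma>: "\<gamma> i \<in> carrier E" if i: "i < N" for i
    unfolding \<gamma>_def
  proof (rule restrict_in_E)
    show "(\<lambda>a. h (pure \<one>\<^bsub>A\<^esub> a) i) \<in> additive_maps A A"
      using balanced_pure additive_maps_closed[OF h_eval[OF i]] additive_maps_add[OF h_eval[OF i]]
      by (intro additive_mapsI) (simp_all add: balanced_def)
    fix b a assume "b \<in> carrier B" "a \<in> carrier A"
    \<comment> \<open>Balancedness moves b across the tensor sign, 1 \<otimes> ba = b \<otimes> a,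
      after which \<open>h_pure\<close> pulls b out on the left.\<close>
    moreover from this have "pure \<one>\<^bsub>A\<^esub> (\<phi> b \<otimes>\<^bsub>A\<^esub> a) = pure (\<phi> b) a"
      using balanced_pure A.one_closed A.l_one hom_closed unfolding balanced_def by metis
    ultimately show "h (pure \<one>\<^bsub>A\<^esub> (\<phi> b \<otimes>\<^bsub>A\<^esub> a)) i = \<phi> b \<otimes>\<^bsub>A\<^esub> h (pure \<one>\<^bsub>A\<^esub> a) i"
      using h_pure[of "\<phi> b" a i] i by simp
  next
    fix a c assume ac: "a \<in> carrier A" "c \<in> carrier C"
    then have "pure \<one>\<^bsub>A\<^esub> (a \<otimes>\<^bsub>A\<^esub> \<phi> (\<psi> c)) = tensor_ract A B \<phi> (pure \<one>\<^bsub>A\<^esub> a) (\<phi> (\<psi> c))"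
      by (simp add: tensor_ract_additive(2))
    with ac i show "h (pure \<one>\<^bsub>A\<^esub> (a \<otimes>\<^bsub>A\<^esub> \<phi> (\<psi> c))) i = h (pure \<one>\<^bsub>A\<^esub> a) i \<otimes>\<^bsub>A\<^esub> \<phi> (\<psi> c)"
      by (simp add: h_ract ract_def)
  qed
  have h_pairing: "h p i = pairing A p (\<gamma> i)" if "p \<in> carrier T" "i < N" for p i
  proof (rule tensor_additive_eq[OF A.abelian_group_axioms h_eval[OF that(2)]
        pairing_additive_End[OF \<gamma>[OF that(2)]] _ that(1)])
    fix a y assume ay: "a \<in> carrier A" "y \<in> carrier A"
    then have "\<gamma> i y = h (pure \<one>\<^bsub>A\<^esub> y) i"
      by (simp add: \<gamma>_def)
    with ay show "h (pure a y) i = pairing A (pure a y) (\<gamma> i)"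
      using h_pure[OF ay that(2)] \<gamma>[OF that(2)] by simp
  qed

  have expansion: "p = (\<Oplus>\<^bsub>T\<^esub>i\<in>{..<N}. tensor_lact A B \<phi> (pairing A p (\<gamma> i)) (u i))"
    if p: "p \<in> carrier T" for p
  proof -
    let ?a = "\<lambda>i. h p i"
    have a: "?a i \<in> carrier A" if "i < N" for i
      using additive_maps_closed[OF h_eval[OF that] p] .
    have hp: "h p \<in> carrier M" using h_H[OF p] by (rule H.a_Hcarr)
    have le: "(\<lambda>i. lact (?a i) (e i)) \<in> {..<N} \<rightarrow> carrier M"
      using a e lact_closed by auto
    have "h p = (\<Oplus>\<^bsub>M\<^esub>i\<in>{..<N}. lact (?a i) (e i))"
    proof (rule PiE_ext)
      show "h p \<in> {..<N} \<rightarrow>\<^sub>E carrier A" "(\<Oplus>\<^bsub>M\<^esub>i\<in>{..<N}. lact (?a i) (e i)) \<in> {..<N} \<rightarrow>\<^sub>E carrier A"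
        using hp M.finsum_closed[OF le] by (simp_all add: M_carrier)
      fix j assume "j \<in> {..<N}"
      then have j: "j < N" by simp
      have "(\<Oplus>\<^bsub>M\<^esub>i\<in>{..<N}. lact (?a i) (e i)) j = (\<Oplus>\<^bsub>A\<^esub>i\<in>{..<N}. lact (?a i) (e i) j)"
        by (rule additive_maps_finsum[OF M.abelian_group_axioms A.abelian_group_axioms eval[OF j] _ le]) simp
      also have "\<dots> = (\<Oplus>\<^bsub>A\<^esub>i\<in>{..<N}. if j = i then ?a i else \<zero>\<^bsub>A\<^esub>)"
        using a j by (intro A.finsum_cong') (auto simp: lact_def e_def)
      also have "\<dots> = ?a j"
        using a j by (intro A.finsum_singleton) auto
      finally show "h p j = (\<Oplus>\<^bsub>M\<^esub>i\<in>{..<N}. lact (?a i) (e i)) j" by simp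
    qed
    also have "\<dots> = (\<Oplus>\<^bsub>M\<^esub>i\<in>{..<N}. lact (?a i) (x i) \<oplus>\<^bsub>M\<^esub> lact (?a i) (k i))"
      using a xk lact_closed by (intro M.finsum_cong') (auto simp: e_eq lact_add)
    also have "\<dots> = (\<Oplus>\<^bsub>M\<^esub>i\<in>{..<N}. lact (?a i) (x i)) \<oplus>\<^bsub>M\<^esub> (\<Oplus>\<^bsub>M\<^esub>i\<in>{..<N}. lact (?a i) (k i))"
      using a xk lact_closed by (intro M.finsum_addf) auto
    \<comment> \<open>The vector h p lies in \<open>H\<close>, so its component in \<open>K\<close>
      is zero. Writing out this zero lets uniqueness of the decomposition discard the sum over the
      \<open>k i\<close>.\<close>
    finally have eq: "h p \<oplus>\<^bsub>M\<^esub> \<zero>\<^bsub>M\<^esub> =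
        (\<Oplus>\<^bsub>M\<^esub>i\<in>{..<N}. lact (?a i) (x i)) \<oplus>\<^bsub>M\<^esub> (\<Oplus>\<^bsub>M\<^esub>i\<in>{..<N}. lact (?a i) (k i))"
      using hp by simp
    have "(\<Oplus>\<^bsub>M\<^esub>i\<in>{..<N}. lact (?a i) (x i)) \<in> H"
      using a lact_sub(1)[OF _ x]
      by (intro finsum_submonoid[OF M.abelian_group_axioms H.a_subset]) (auto intro: H.a_closed)
    moreover have "(\<Oplus>\<^bsub>M\<^esub>i\<in>{..<N}. lact (?a i) (k i)) \<in> K"
      using a lact_sub(2)[OF _ k]
      by (intro finsum_submonoid[OF M.abelian_group_axioms K.a_subset]) (auto intro: K.a_closed)
    ultimately have "h p = (\<Oplus>\<^bsub>M\<^esub>i\<in>{..<N}. lact (?a i) (x i))"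
      using unique[OF h_H[OF p] _ K.zero_closed _ eq] by blast
    also have "\<dots> = (\<Oplus>\<^bsub>M\<^esub>i\<in>{..<N}. h (tensor_lact A B \<phi> (pairing A p (\<gamma> i)) (u i)))"
      using a u xk lact_closed p by (intro M.finsum_cong') (auto simp: h_lact hu h_pairing)
    also have "\<dots> = h (\<Oplus>\<^bsub>T\<^esub>i\<in>{..<N}. tensor_lact A B \<phi> (pairing A p (\<gamma> i)) (u i))"
      using u p \<gamma>
      by (intro additive_maps_finsum[symmetric, OF T.abelian_group_axioms M.abelian_group_axioms h_add]) auto
    finally show ?thesis
      using u p \<gamma> by (intro h_inj) (auto intro!: T.finsum_closed)
  qed
  show thesis
    using that[OF \<gamma> uP expansion] .
qed

text \<open>Additivity in the scalar yields 0q = 0, which makes the expansion collapse once all its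
  coefficients vanish.\<close>

lemma tensor_lact_additive_scalar:
  assumes "q \<in> carrier T"
  shows "(\<lambda>a. tensor_lact A B \<phi> a q) \<in> additive_maps A T"
proof (rule additive_mapsI)
  fix a a' assume a: "a \<in> carrier A" "a' \<in> carrier A"
  have sum: "(\<lambda>q. tensor_lact A B \<phi> a q \<oplus>\<^bsub>T\<^esub> tensor_lact A B \<phi> a' q) \<in> additive_maps T T"
    using a by (intro additive_mapsI)
      (simp_all add: additive_maps_add[OF tensor_lact_additive(1)] T.a_ac)
  have "a \<oplus>\<^bsub>A\<^esub> a' \<in> carrier A" using a by simp
  then show "tensor_lact A B \<phi> (a \<oplus>\<^bsub>A\<^esub> a') q = tensor_lact A B \<phi> a q \<oplus>\<^bsub>T\<^esub> tensor_lact A B \<phi> a' q"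
    by (rule tensor_additive_eq[OF T.abelian_group_axioms tensor_lact_additive(1) sum _ assms])
      (use a balanced_pure in \<open>simp add: tensor_lact_additive(2) A.l_distr balanced_def\<close>)
qed (use assms in simp)

text \<open>\<open>F\<close> is additive from \<open>P\<close> to \<open>V\<close>, whereas the dual
  basis produces sums formed in \<open>T\<close> and \<open>A\<close>. The induction keeps every
  partial sum inside \<open>P\<close>, where additivity of \<open>F\<close> applies.\<close>

lemma dual_finsum:
  assumes "F \<in> carrier D" "finite I" "g \<in> I \<rightarrow> carrier P"
  shows "F (\<Oplus>\<^bsub>T\<^esub>i\<in>I. g i) = (\<Oplus>\<^bsub>A\<^esub>i\<in>I. F (g i))"
  using assms(2,3)
proof (induction I rule: finite_induct)
  case empty
  \<comment> \<open>Additivity at 0 + 0 gives F(0) + F(0) = F(0), and cancellation in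
    \<open>A\<close> leaves F(0) = 0.\<close>
  have "F \<zero>\<^bsub>T\<^esub> = F (\<zero>\<^bsub>T\<^esub> \<oplus>\<^bsub>P\<^esub> \<zero>\<^bsub>T\<^esub>)"
    by (simp add: P_ops)
  also have "\<dots> = F \<zero>\<^bsub>T\<^esub> \<oplus>\<^bsub>V\<^esub> F \<zero>\<^bsub>T\<^esub>"
    by (rule D_add[OF assms(1)]) simp_all
  finally have "F \<zero>\<^bsub>T\<^esub> \<oplus>\<^bsub>A\<^esub> F \<zero>\<^bsub>T\<^esub> = F \<zero>\<^bsub>T\<^esub>"
    by (simp add: V_ops)
  moreover have "F \<zero>\<^bsub>T\<^esub> \<in> carrier A"
    using D_closed[OF assms(1) P_zero_closed] by simp
  ultimately show ?case
    by (simp add: A.add.l_cancel_one)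
next
  case (insert i I)
  have P: "(\<Oplus>\<^bsub>T\<^esub>i\<in>I. g i) \<in> carrier P"
    using insert by (intro finsum_submonoid[OF T.abelian_group_axioms]) auto
  have g: "g \<in> I \<rightarrow> carrier T" "g i \<in> carrier P" "(\<lambda>i. F (g i)) \<in> I \<rightarrow> carrier A" "F (g i) \<in> carrier A"
    using insert.prems D_closed[OF assms(1)] by (auto simp: Pi_iff)
  have "F (\<Oplus>\<^bsub>T\<^esub>j\<in>insert i I. g j) = F (g i \<oplus>\<^bsub>P\<^esub> (\<Oplus>\<^bsub>T\<^esub>i\<in>I. g i))"
    using insert g by (simp add: T.finsum_insert P_ops)
  also have "\<dots> = F (g i) \<oplus>\<^bsub>A\<^esub> F (\<Oplus>\<^bsub>T\<^esub>i\<in>I. g i)"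
    using D_add[OF assms(1) g(2) P] by (simp add: V_ops)
  finally show ?case
    using insert g by (simp add: A.finsum_insert)
qed

section \<open>Nondegeneracy and the isomorphism\<close>

lemma tensor_centralizer_eq_zeroI:
  assumes "right_depth_three A B C \<phi> \<psi>" "p \<in> carrier P"
    and "\<And>\<alpha>. \<alpha> \<in> carrier E \<Longrightarrow> pairing A p \<alpha> = \<zero>\<^bsub>A\<^esub>"
  shows "p = \<zero>\<^bsub>T\<^esub>"
proof -
  obtain N :: nat and \<gamma> u where \<gamma>: "\<And>i. i < N \<Longrightarrow> \<gamma> i \<in> carrier E"
    and u: "\<And>i. i < N \<Longrightarrow> u i \<in> carrier P"
    and eq: "\<And>p. p \<in> carrier T \<Longrightarrow> p = (\<Oplus>\<^bsub>T\<^esub>i\<in>{..<N}. tensor_lact A B \<phi> (pairing A p (\<gamma> i)) (u i))"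
    by (fact dual_basis[OF assms(1)])
  have zero: "tensor_lact A B \<phi> \<zero>\<^bsub>A\<^esub> q = \<zero>\<^bsub>T\<^esub>" if "q \<in> carrier T" for q
    using additive_maps_zero[OF A.abelian_group_axioms T.abelian_group_axioms tensor_lact_additive_scalar[OF that]]
    by simp
  have "p = (\<Oplus>\<^bsub>T\<^esub>i\<in>{..<N}. tensor_lact A B \<phi> (pairing A p (\<gamma> i)) (u i))"
    using assms(2) by (intro eq) simp
  also have "\<dots> = (\<Oplus>\<^bsub>T\<^esub>i\<in>{..<N}. \<zero>\<^bsub>T\<^esub>)"
    using u assms(3) \<gamma> by (intro T.finsum_cong') (simp_all add: zero)
  finally show ?thesis by simp
qed

text \<open>The form with two maps serves twice: for injectivity of the induced map and, with
  \<beta> the zero of \<open>E\<close>, for nondegeneracy in the second argument.\<close>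

lemma bimodule_End_eqI:
  assumes "right_depth_three A B C \<phi> \<psi>" "\<alpha> \<in> carrier E" "\<beta> \<in> carrier E"
    and "\<And>p. p \<in> carrier P \<Longrightarrow> pairing A p \<alpha> = pairing A p \<beta>"
  shows "\<alpha> = \<beta>"
proof -
  obtain N :: nat and \<gamma> u where \<gamma>: "\<And>i. i < N \<Longrightarrow> \<gamma> i \<in> carrier E"
    and u: "\<And>i. i < N \<Longrightarrow> u i \<in> carrier P"
    and eq: "\<And>p. p \<in> carrier T \<Longrightarrow> p = (\<Oplus>\<^bsub>T\<^esub>i\<in>{..<N}. tensor_lact A B \<phi> (pairing A p (\<gamma> i)) (u i))"
    by (fact dual_basis[OF assms(1)])
  \<comment> \<open>Pairing the expansion of p with \<delta> moves the coefficients out on the left;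
    on the right-hand side \<delta> then occurs only through its pairings with the elements
    \<open>u i\<close> of \<open>P\<close>.\<close>
  have expand: "pairing A p \<delta> = (\<Oplus>\<^bsub>A\<^esub>i\<in>{..<N}. pairing A p (\<gamma> i) \<otimes>\<^bsub>A\<^esub> pairing A (u i) \<delta>)"
    if "p \<in> carrier T" "\<delta> \<in> carrier E" for p \<delta>
  proof -
    have "pairing A p \<delta> = pairing A (\<Oplus>\<^bsub>T\<^esub>i\<in>{..<N}. tensor_lact A B \<phi> (pairing A p (\<gamma> i)) (u i)) \<delta>"
      using eq[OF that(1)] by (rule arg_cong)
    also have "\<dots> = (\<Oplus>\<^bsub>A\<^esub>i\<in>{..<N}. pairing A (tensor_lact A B \<phi> (pairing A p (\<gamma> i)) (u i)) \<delta>)"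
      using that \<gamma> u
      by (intro additive_maps_finsum[OF T.abelian_group_axioms A.abelian_group_axioms pairing_additive_End])
        auto
    also have "\<dots> = (\<Oplus>\<^bsub>A\<^esub>i\<in>{..<N}. pairing A p (\<gamma> i) \<otimes>\<^bsub>A\<^esub> pairing A (u i) \<delta>)"
      using that \<gamma> u by (intro A.finsum_cong') (auto simp: pairing_lact)
    finally show ?thesis .
  qed
  show ?thesis
  proof (rule extensionalityI[of _ "carrier A"])
    fix a assume a: "a \<in> carrier A"
    then have p: "pure \<one>\<^bsub>A\<^esub> a \<in> carrier T" by simp
    have "(\<Oplus>\<^bsub>A\<^esub>i\<in>{..<N}. pairing A (pure \<one>\<^bsub>A\<^esub> a) (\<gamma> i) \<otimes>\<^bsub>A\<^esub> pairing A (u i) \<alpha>) =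
        (\<Oplus>\<^bsub>A\<^esub>i\<in>{..<N}. pairing A (pure \<one>\<^bsub>A\<^esub> a) (\<gamma> i) \<otimes>\<^bsub>A\<^esub> pairing A (u i) \<beta>)"
      using p assms(3,4) u \<gamma> by (intro A.finsum_cong') (auto simp del: pairing_pure)
    then have "pairing A (pure \<one>\<^bsub>A\<^esub> a) \<alpha> = pairing A (pure \<one>\<^bsub>A\<^esub> a) \<beta>"
      by (simp only: expand[OF p assms(2)] expand[OF p assms(3)])
    with a assms(2,3) show "\<alpha> a = \<beta> a" by simp
  qed (use assms in \<open>simp_all add: E_iff\<close>)
qed

text \<open>For p in \<open>P\<close> the coefficients \<langle>p, \<gamma>_i\<rangle> lie in
  \<open>V\<close>, so \<open>V\<close>-linearity turns the expansion into F(p) = \<Sum> \<langle>p,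
  \<gamma>_i\<rangle> F(u_i). Each F(u_i) lies in \<open>V\<close> as well, so the right action on
  \<open>E\<close> absorbs it into \<gamma>_i.\<close>

lemma dual_surjective:
  assumes "right_depth_three A B C \<phi> \<psi>" "F \<in> carrier D"
  obtains \<alpha> where "\<alpha> \<in> carrier E" "\<And>p. p \<in> carrier P \<Longrightarrow> pairing A p \<alpha> = F p"
proof -
  obtain N :: nat and \<gamma> u where \<gamma>: "\<And>i. i < N \<Longrightarrow> \<gamma> i \<in> carrier E"
    and u: "\<And>i. i < N \<Longrightarrow> u i \<in> carrier P"
    and eq: "\<And>p. p \<in> carrier T \<Longrightarrow> p = (\<Oplus>\<^bsub>T\<^esub>i\<in>{..<N}. tensor_lact A B \<phi> (pairing A p (\<gamma> i)) (u i))"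
    by (fact dual_basis[OF assms(1)])
  interpret E: abelian_group E by (rule abelian_group_End)
  have Fu: "F (u i) \<in> carrier V" if "i < N" for i
    using u[OF that] assms(2) by (rule D_closed[rotated])
  define \<beta> where "\<beta> i = End_ract A (\<gamma> i) (F (u i))" for i
  have \<beta>: "\<beta> i \<in> carrier E" if "i < N" for i
    unfolding \<beta>_def End_ract_def using \<gamma> Fu that by (intro End_ract_closed)
  have "pairing A p (\<Oplus>\<^bsub>E\<^esub>i\<in>{..<N}. \<beta> i) = F p" if p: "p \<in> carrier P" for p
  proof -
    have "(\<lambda>\<alpha>. pairing A p \<alpha>) \<in> additive_maps E A"
      using p by (intro additive_mapsI) (simp_all add: pairing_plus)
    then have "pairing A p (\<Oplus>\<^bsub>E\<^esub>i\<in>{..<N}. \<beta> i) = (\<Oplus>\<^bsub>A\<^esub>i\<in>{..<N}. pairing A p (\<beta> i))"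
      using \<beta> by (intro additive_maps_finsum[OF E.abelian_group_axioms A.abelian_group_axioms]) auto
    also have "\<dots> = (\<Oplus>\<^bsub>A\<^esub>i\<in>{..<N}. F (tensor_lact A B \<phi> (pairing A p (\<gamma> i)) (u i)))"
      using p \<gamma> u Fu
      by (intro A.finsum_cong')
        (auto simp: \<beta>_def pairing_End_ract D_lact[OF assms(2)] V_ops)
    also have "\<dots> = F (\<Oplus>\<^bsub>T\<^esub>i\<in>{..<N}. tensor_lact A B \<phi> (pairing A p (\<gamma> i)) (u i))"
      using p \<gamma> u by (intro dual_finsum[OF assms(2), symmetric]) auto
    also have "\<dots> = F p"
      using eq[of p] p by simp
    finally show ?thesis .
  qed
  moreover have "(\<Oplus>\<^bsub>E\<^esub>i\<in>{..<N}. \<beta> i) \<in> carrier E"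
    using \<beta> by (intro E.finsum_closed) auto
  ultimately show thesis using that by blast
qed

text \<open>\<open>pairing_lact\<close> gives left \<open>V\<close>-linearity of each image, and
  \<open>pairing_End_ract\<close> gives right \<open>V\<close>-linearity of the assignment. Because
  of the restriction to the carrier of \<open>P\<close>, two images are equal as functions exactly
  when the pairings agree on \<open>P\<close>, which is the premise of
  \<open>bimodule_End_eqI\<close>.\<close>

lemma pairing_dual_iso:
  assumes "right_depth_three A B C \<phi> \<psi>"
  shows "(\<lambda>\<alpha>. \<lambda>p\<in>carrier P. pairing A p \<alpha>) \<in> right_module_isos V E (End_ract A) D (left_dual_ract V P)"
    (is "?\<Theta> \<in> _")
proof -
  have D: "?\<Theta> \<alpha> \<in> carrier D" if "\<alpha> \<in> carrier E" for \<alpha>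
    using that by (intro restrict_in_D)
      (simp_all add: P_ops V_ops pairing_lact additive_maps_add[OF pairing_additive_End])
  interpret E: abelian_group E by (rule abelian_group_End)
  have "?\<Theta> \<in> additive_maps E D"
    using D by (intro additive_mapsI) (auto simp: pairing_plus V_ops left_dual_def[of V P])
  moreover have "?\<Theta> (End_ract A \<alpha> v) = left_dual_ract V P (?\<Theta> \<alpha>) v"
    if "\<alpha> \<in> carrier E" "v \<in> carrier V" for \<alpha> v
    using that by (auto simp: left_dual_ract_def pairing_End_ract V_ops)
  moreover have "bij_betw ?\<Theta> (carrier E) (carrier D)"
    unfolding bij_betw_def
  proof (intro conjI inj_onI subset_antisym subsetI)
    fix \<alpha> \<beta> assume \<alpha>\<beta>: "\<alpha> \<in> carrier E" "\<beta> \<in> carrier E" "?\<Theta> \<alpha> = ?\<Theta> \<beta>"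
    have "pairing A p \<alpha> = pairing A p \<beta>" if "p \<in> carrier P" for p
      using fun_cong[OF \<alpha>\<beta>(3), of p] that by simp
    with \<alpha>\<beta> show "\<alpha> = \<beta>" by (intro bimodule_End_eqI[OF assms])
  next
    fix F assume F: "F \<in> carrier D"
    obtain \<alpha> where "\<alpha> \<in> carrier E" "\<And>p. p \<in> carrier P \<Longrightarrow> pairing A p \<alpha> = F p"
      by (fact dual_surjective[OF assms F])
    \<comment> \<open>Both \<open>F\<close> and the restricted pairing are extensional, so agreement
      on \<open>P\<close> is equality of functions.\<close>
    moreover have "F \<in> extensional (carrier P)" using F by (simp add: D_iff)
    ultimately show "F \<in> ?\<Theta> ` carrier E"
      by (intro image_eqI[of _ _ \<alpha>]) (auto intro!: extensionalityI[of _ "carrier P"])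
  qed (use D in blast)
  ultimately show ?thesis
    by (simp add: right_module_isos_def)
qed

end

theorem lemma4p4:
  fixes A :: "('a, 'k) ring_scheme" and B :: "('b, 'l) ring_scheme" and C :: "('c, 'm) ring_scheme"
    and \<phi> :: "'b \<Rightarrow> 'a" and \<psi> :: "'c \<Rightarrow> 'b"
  assumes "right_depth_three A B C \<phi> \<psi>"
  shows
    "let V = centralizer A C \<phi> \<psi>;
         P = tensor_centralizer A B C \<phi> \<psi>;
         E = bimodule_End A B C \<phi> \<psi>;
         D = left_dual V P (tensor_lact A B \<phi>)
     in (\<forall>p \<in> carrier P. \<forall>\<alpha> \<in> carrier E. pairing A p \<alpha> \<in> carrier V) \<and>
        nondegenerate P E V (pairing A) \<and>
        right_module V E (End_ract A) \<and>
        right_module V D (left_dual_ract V P) \<and>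
        (\<lambda>\<alpha>. \<lambda>p\<in>carrier P. pairing A p \<alpha>)
          \<in> right_module_isos V E (End_ract A) D (left_dual_ract V P)"
proof -
  have "ring_tower A B C \<phi> \<psi>"
    using assms by (simp add: right_depth_three_def)
  then interpret tower A B \<phi> C \<psi>
    unfolding ring_tower_def tower_def ring_extension_def ring_extension_axioms_def tower_axioms_def
    by blast
  interpret E: abelian_group E by (rule abelian_group_End)
  \<comment> \<open>Vanishing of all \<langle>p, \<alpha>\<rangle> is to be read as agreement with
    the zero of \<open>E\<close>; the pairing with that zero vanishes because the pairing is
    additive in its second argument.\<close>
  have "pairing A p \<zero>\<^bsub>E\<^esub> = \<zero>\<^bsub>A\<^esub>" if "p \<in> carrier P" for p
  proof -
    have "(\<lambda>\<alpha>. pairing A p \<alpha>) \<in> additive_maps E A"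
      using that by (intro additive_mapsI) (simp_all add: pairing_plus)
    then show ?thesis
      by (rule additive_maps_zero[OF abelian_group_End A.abelian_group_axioms])
  qed
  then have "\<alpha> = \<zero>\<^bsub>E\<^esub>" if "\<alpha> \<in> carrier E" "\<forall>p\<in>carrier P. pairing A p \<alpha> = \<zero>\<^bsub>A\<^esub>" for \<alpha>
    using that by (intro bimodule_End_eqI[OF assms]) auto
  then have "nondegenerate P E V (pairing A)"
    using tensor_centralizer_eq_zeroI[OF assms] by (auto simp: nondegenerate_def V_ops P_ops)
  then show ?thesis
    using right_module_End right_module_dual pairing_dual_iso[OF assms] by (simp add: Let_def)
qed

end
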